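(* Let $\mathbb{C}_+=\{z\in\mathbb{C}:\operatorname{Im}z>0\}$ and let $\lambda>0$. Put $P_{i\lambda}(x)=\frac1\pi\frac{\lambda}{\lambda^2+x^2}$ for $x\in\mathbb{R}$ and $Q(z,w)=\frac{1}{2\pi}\frac{i}{z-\overline w}$ for $z,w\in\mathbb{C}_+$. Then: (a) The Fourier transform of the positive function (viewed as a measure) $P_{i\lambda}$ is the reflection positive function on $(\mathbb{R},\mathbb{R}_+,-\mathrm{id}_{\mathbb{R}})$ given by $$\varphi_\lambda(t):=\widehat{P_{i\lambda}}(t)=\int_{\mathbb{R}}e^{itx}P_{i\lambda}(x)\,dx=e^{-\lambda|t|}\quad\text{ for } t\in\mathbb{R}.$$ (b) The function $$F_\lambda(z):=\frac{Q(z,i\lambda)}{\sqrt{Q(i\lambda,i\lambda)}}=\sqrt{\frac{\lambda}{\pi}}\,\frac{i}{z+i\lambda}$$ is outer in $H^2(\mathbb{C}_+)$ and its boundary values $F_\lambda^*$ on $\mathbb{R}$ satisfy $|F_\lambda^*|^2=P_{i\lambda}$. With $$h_\lambda(x)=\frac{F_\lambda^*(x)}{F_\lambda^*(-x)}=\frac{i\lambda-x}{i\lambda+x}\in\mathbb{T}$$ we obtain on $L^2(\mathbb{R})$ a unitary involution $(\theta_{h_\lambda}f)(x):=h_\lambda(x)f(-x)$ fixing $F_\lambda^*$, and, for the unitary one-parameter group $(U_tf)(x)=e^{itx}f(x)$ on $L^2(\mathbb{R})$, $$\langle F_\lambda^*,U_tF_\lambda^*\rangle=\varphi_\lambda(t)\quad\text{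 for } t\in\mathbb{R}.$$
   Context: Inner products are linear in the second argument. $\mathbb{T}=\{z\in\mathbb{C}:|z|=1\}$, $\mathbb{R}_+=(0,\infty)$. A function $\varphi:\mathbb{R}\to\mathbb{C}$ with $\varphi(-t)=\varphi(t)$ is called reflection positive on $(\mathbb{R},\mathbb{R}_+,-\mathrm{id}_{\mathbb{R}})$ if it is positive definite, i.e. the kernel $(\varphi(t-s))_{t,s\in\mathbb{R}}$ is positive definite, and the kernel $(\varphi(t+s))_{t,s>0}$ is also positive definite. $H^2(\mathbb{C}_+)\subseteq L^2(\mathbb{R})$ is the Hardy space of the upper half plane, identified with a subspace of $L^2(\mathbb{R})$ by non-tangential boundary values $F\mapsto F^*$; $Q$ is its reproducing kernel (Szegő kernel) and $P_{i\lambda}$ is the Poisson kernel of $\mathbb{C}_+$ at $i\lambda$. A function $F\in H^2(\mathbb{C}_+)$ is outer if $H^\infty(\mathbb{C}_+)F$ is dense in $H^2(\mathbb{C}_+)$, where $H^\infty(\mathbb{C}_+)$ is the algebra of bounded holomorphic functions. *)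

theory Defs
  imports
    "HOL-Probability.Probability"
    "HOL-Complex_Analysis.Complex_Analysis"
begin

section \<open>Positive definite kernels and reflection positive functions\<close>

text \<open>Membership in the nonnegative reals includes the claim that the sum is real.\<close>

definition positive_definite_kernel_on :: "'a set \<Rightarrow> ('a \<Rightarrow> 'a \<Rightarrow> complex) \<Rightarrow> bool" where
  "positive_definite_kernel_on X K \<longleftrightarrow>
     (\<forall>S c. finite S \<and> S \<subseteq> X \<longrightarrow>
        (\<Sum>x\<in>S. \<Sum>y\<in>S. cnj (c x) * c y * K x y) \<in> \<real>\<^sub>\<ge>\<^sub>0)"

definition reflection_positive :: "(real \<Rightarrow> complex) \<Rightarrow> bool" where
  "reflection_positive \<phi> \<longleftrightarrow>
     (\<forall>t. \<phi> (- t) = \<phi> t) \<and>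
     positive_definite_kernel_on UNIV (\<lambda>t s. \<phi> (t - s)) \<and>
     positive_definite_kernel_on {0<..} (\<lambda>t s. \<phi> (t + s))"


section \<open>The space \<open>L\<^sup>2(\<real>)\<close>\<close>

text \<open>
  Elements of the Hilbert space are represented by measurable square-integrable functions, and
  equality in it is the relation \<open>L2_eq\<close>. Operators act on representatives; that they
  descend to almost-everywhere classes is part of \<open>L2_unitary\<close>. The inner product is linear in
  the second argument.
\<close>

definition L2 :: "(real \<Rightarrow> complex) set" where
  "L2 = {f \<in> borel_measurable lborel. integrable lborel (\<lambda>x. (cmod (f x))\<^sup>2)}"

definition L2_eq :: "(real \<Rightarrow> complex) \<Rightarrow> (real \<Rightarrow> complex) \<Rightarrow> bool" where
  "L2_eq f g \<longleftrightarrow> (AE x in lborel. f x = g x)"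

definition L2_inner :: "(real \<Rightarrow> complex) \<Rightarrow> (real \<Rightarrow> complex) \<Rightarrow> complex" where
  "L2_inner f g = (\<integral>x. cnj (f x) * g x \<partial>lborel)"

definition L2_norm :: "(real \<Rightarrow> complex) \<Rightarrow> real" where
  "L2_norm f = sqrt (\<integral>x. (cmod (f x))\<^sup>2 \<partial>lborel)"

definition L2_unitary :: "((real \<Rightarrow> complex) \<Rightarrow> (real \<Rightarrow> complex)) \<Rightarrow> bool" where
  "L2_unitary T \<longleftrightarrow>
     (\<forall>f\<in>L2. T f \<in> L2) \<and>
     (\<forall>f\<in>L2. \<forall>g\<in>L2. L2_eq f g \<longrightarrow> L2_eq (T f) (T g)) \<and>
     (\<forall>f\<in>L2. \<forall>g\<in>L2. \<forall>a b. L2_eq (T (\<lambda>x. a * f x + b * g x)) (\<lambda>x. a * T f x + b * T g x)) \<and>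
     (\<forall>f\<in>L2. \<forall>g\<in>L2. L2_inner (T f) (T g) = L2_inner f g) \<and>
     (\<forall>g\<in>L2. \<exists>f\<in>L2. L2_eq (T f) g)"

definition L2_unitary_involution :: "((real \<Rightarrow> complex) \<Rightarrow> (real \<Rightarrow> complex)) \<Rightarrow> bool" where
  "L2_unitary_involution T \<longleftrightarrow> L2_unitary T \<and> (\<forall>f\<in>L2. L2_eq (T (T f)) f)"

text \<open>As usual, one-parameter groups are required to be strongly continuous.\<close>

definition L2_unitary_one_parameter_group ::
    "(real \<Rightarrow> (real \<Rightarrow> complex) \<Rightarrow> (real \<Rightarrow> complex)) \<Rightarrow> bool" where
  "L2_unitary_one_parameter_group U \<longleftrightarrow>
     (\<forall>t. L2_unitary (U t)) \<and>
     (\<forall>f\<in>L2. L2_eq (U 0 f) f) \<and>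
     (\<forall>s t. \<forall>f\<in>L2. L2_eq (U (s + t) f) (U s (U t f))) \<and>
     (\<forall>f\<in>L2. \<forall>t. ((\<lambda>s. L2_norm (\<lambda>x. U s f x - U t f x)) \<longlongrightarrow> 0) (at t))"


section \<open>Hardy spaces of the upper half plane\<close>

definition upper_half_plane :: "complex set" where
  "upper_half_plane = {z. Im z > 0}"

definition hardy_norm_sq :: "(complex \<Rightarrow> complex) \<Rightarrow> ennreal" where
  "hardy_norm_sq F =
     (SUP y\<in>{0<..}. \<integral>\<^sup>+x. ennreal ((cmod (F (Complex x y)))\<^sup>2) \<partial>lborel)"

definition H2 :: "(complex \<Rightarrow> complex) set" where
  "H2 = {F. F holomorphic_on upper_half_plane \<and> hardy_norm_sq F < \<infinity>}"

definition Hinf :: "(complex \<Rightarrow> complex) set" where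
  "Hinf = {g. g holomorphic_on upper_half_plane \<and> bounded (g ` upper_half_plane)}"

text \<open>The second conjunct is density of \<open>H\<^sup>\<infinity> F\<close> in \<open>H\<^sup>2\<close> for the \<open>H\<^sup>2\<close> norm.\<close>

definition outer_H2 :: "(complex \<Rightarrow> complex) \<Rightarrow> bool" where
  "outer_H2 F \<longleftrightarrow> F \<in> H2 \<and>
     (\<forall>G\<in>H2. \<forall>\<epsilon>>0::real. \<exists>g\<in>Hinf. hardy_norm_sq (\<lambda>z. G z - g z * F z) < ennreal (\<epsilon>\<^sup>2))"

definition has_nontangential_limit :: "(complex \<Rightarrow> complex) \<Rightarrow> real \<Rightarrow> complex \<Rightarrow> bool" where
  "has_nontangential_limit F x w \<longleftrightarrow>
     (\<forall>a>0. (F \<longlongrightarrow> w) (at (complex_of_real x) within {z. Im z > 0 \<and> \<bar>Re z - x\<bar> < a * Im z}))"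

definition boundary_value :: "(complex \<Rightarrow> complex) \<Rightarrow> real \<Rightarrow> complex" where
  "boundary_value F x = (THE w. has_nontangential_limit F x w)"


section \<open>The functions attached to \<open>\<lambda>\<close>\<close>

definition poisson :: "real \<Rightarrow> real \<Rightarrow> real" where
  "poisson l x = 1 / pi * (l / (l\<^sup>2 + x\<^sup>2))"

definition szego :: "complex \<Rightarrow> complex \<Rightarrow> complex" where
  "szego z w = 1 / (2 * of_real pi) * (\<i> / (z - cnj w))"

text \<open>\<open>char\<close> is the Fourier transform of a measure, with kernel \<open>exp (\<i> t x)\<close>.\<close>

definition phi :: "real \<Rightarrow> real \<Rightarrow> complex" where
  "phi l t = char (density lborel (\<lambda>x. ennreal (poisson l x))) t"

definition F_outer :: "real \<Rightarrow> complex \<Rightarrow> complex" where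
  "F_outer l z = szego z (\<i> * of_real l) / csqrt (szego (\<i> * of_real l) (\<i> * of_real l))"

definition h_fun :: "real \<Rightarrow> real \<Rightarrow> complex" where
  "h_fun l x = boundary_value (F_outer l) x / boundary_value (F_outer l) (- x)"

definition theta :: "(real \<Rightarrow> complex) \<Rightarrow> (real \<Rightarrow> complex) \<Rightarrow> real \<Rightarrow> complex" where
  "theta h f x = h x * f (- x)"

definition mod_group :: "real \<Rightarrow> (real \<Rightarrow> complex) \<Rightarrow> real \<Rightarrow> complex" where
  "mod_group t f x = exp (\<i> * of_real t * of_real x) * f x"

end

theory Submission
  imports Defs "HOL-Real_Asymp.Real_Asymp"
begin

text \<open>
  Part (a) is a residue computation for the Poisson kernel, closed in the upper half plane for
  \<open>t \<ge> 0\<close> and reflected by conjugation for \<open>t < 0\<close> (\<open>fourier_poisson\<close>). Positive definiteness of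
  \<open>phi l (t - s)\<close> holds for the Fourier transform of any positive measure, and \<open>exp (- l (t + s))\<close>
  is a kernel of rank one (\<open>reflection_positive_phi\<close>).

  In part (b) everything except outerness is explicit: \<open>F_outer l\<close> is a constant times
  \<open>1 / (z + \<i> l)\<close>, it extends continuously to the real line, its modulus squared there is the
  Poisson kernel, and \<open>h_fun l x\<close> is a unimodular function with \<open>h (- x) h x = 1\<close>. The matrix
  coefficient of \<open>mod_group\<close> is then the Fourier integral of part (a).

  For outerness, every \<open>G\<close> in \<open>H\<^sup>2\<close> has to be approximated by bounded multiples of \<open>F_outer l\<close>, that is,
  by holomorphic functions whose product with \<open>z + \<i> l\<close> is bounded. The approximants are
  \<open>G (z + \<i> d) \<cdot> \<i> n / (z + \<i> d + \<i> n)\<close>: a vertical shift makes \<open>G\<close> bounded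
  (\<open>H2_bounded_above_line\<close>), and the second factor supplies the decay. That they
  converge in \<open>H\<^sup>2\<close> (\<open>H2_approximation\<close>) rests on the energy
  \<open>M y = \<integral> \<bar>F (x + \<i> y)\<bar>\<^sup>2 dx\<close> of a Hardy function on horizontal lines. Shifting a line integral
  of \<open>F z * cnj (F (cnj z + \<i> (a + b)))\<close> from height \<open>a\<close> to height \<open>(a + b) / 2\<close> yields
  \<open>\<integral> \<bar>F (x + \<i> a) - F (x + \<i> b)\<bar>\<^sup>2 dx = M a + M b - 2 M ((a + b) / 2)\<close> (\<open>H2_parallelogram\<close>).
  So \<open>M\<close> is midpoint convex; being bounded, it is decreasing (\<open>line_energy_antimono\<close>), and it
  has a finite limit at \<open>0\<close>. Monotonicity reduces norms in \<open>H\<^sup>2\<close> to lines close to the boundary, or to a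
  single line after a shift, and the finite limit makes the traces of \<open>F\<close> on low lines a Cauchy family.

  Both the shift of line integrals and the boundedness of shifted Hardy functions come from one
  observation about primitives, explained at \<open>L1_bounded_on_strip\<close>. In this way the boundary
  theory of \<open>H\<^sup>2\<close> and Plancherel's theorem are avoided.
\<close>

section \<open>Horizontal lines\<close>

definition strip :: "real \<Rightarrow> real \<Rightarrow> complex set" where
  "strip a b = {z. a < Im z \<and> Im z < b}"

lemma open_strip: "open (strip a b)"
  unfolding strip_def by (intro open_Collect_conj open_Collect_less continuous_intros)

lemma convex_strip: "convex (strip a b)"
proof -
  have "strip a b = {z. Im z > a} \<inter> {z. Im z < b}" by (auto simp: strip_def)
  then show ?thesis by (simp add: convex_Int convex_halfspace_Im_gt convex_halfspace_Im_lt)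
qed

lemma continuous_on_horizontal_line:
  assumes "f holomorphic_on S" "\<And>x. Complex x y \<in> S"
  shows "continuous_on UNIV (\<lambda>x. f (Complex x y))"
proof -
  have "continuous_on UNIV (\<lambda>x. Complex x y)"
    unfolding Complex_eq by (intro continuous_intros)
  from continuous_on_compose2[OF holomorphic_on_imp_continuous_on[OF assms(1)] this]
  show ?thesis using assms(2) by auto
qed

lemma borel_measurable_horizontal_line:
  assumes "f holomorphic_on S" "\<And>x. Complex x y \<in> S"
  shows "(\<lambda>x. f (Complex x y)) \<in> borel_measurable borel"
  using continuous_on_horizontal_line[OF assms] by (rule borel_measurable_continuous_onI)

lemma integral_over_horizontal_segment:
  assumes "a \<le> b"
    and deriv: "\<And>x. (F has_field_derivative f (Complex x y)) (at (Complex x y))"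
    and cont: "continuous_on UNIV (\<lambda>x. f (Complex x y))"
  shows "(\<integral>x. indicator {a..b} x *\<^sub>R f (Complex x y) \<partial>lborel) = F (Complex b y) - F (Complex a y)"
proof (rule integral_FTC_Icc[OF assms(1)])
  show "continuous_on {a..b} (\<lambda>x. f (Complex x y))"
    using cont continuous_on_subset by blast
  fix x
  have "((\<lambda>x. Complex x y) has_vector_derivative 1) (at x)"
    unfolding Complex_eq by (auto intro!: derivative_eq_intros)
  from field_vector_diff_chain_at[OF this deriv]
  show "((\<lambda>x. F (Complex x y)) has_vector_derivative f (Complex x y)) (at x within {a..b})"
    by (simp add: o_def has_vector_derivative_at_within)
qed

text \<open>
  L'Hopital's rule, applied to the real and imaginary parts.
\<close>

lemma cesaro_of_derivative:
  fixes f :: "real \<Rightarrow> complex"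
  assumes deriv: "\<And>t. 0 < t \<Longrightarrow> (f has_vector_derivative f' t) (at t)"
    and lim: "(f' \<longlongrightarrow> L) at_top"
  shows "((\<lambda>t. f t / of_real t) \<longlongrightarrow> L) at_top"
proof -
  have *: "((\<lambda>t. p (f t) / t) \<longlongrightarrow> p L) at_top" if p: "bounded_linear p" for p :: "complex \<Rightarrow> real"
  proof (rule lhospital_at_top_at_top[where g' = "\<lambda>_. 1" and f' = "\<lambda>t. p (f' t)"])
    show "eventually (\<lambda>t. ((\<lambda>t. p (f t)) has_real_derivative p (f' t)) (at t)) at_top"
      using eventually_gt_at_top[of 0]
    proof eventually_elim
      case (elim t)
      from bounded_linear.has_vector_derivative[OF p deriv[OF elim]]
      show ?case by (simp add: has_real_derivative_iff_has_vector_derivative)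
    qed
    show "((\<lambda>t. p (f' t) / 1) \<longlongrightarrow> p L) at_top"
      using bounded_linear.tendsto[OF p lim] by simp
  qed (auto intro!: derivative_eq_intros filterlim_ident)
  show ?thesis
    unfolding tendsto_complex_iff
    using *[OF bounded_linear_Re] *[OF bounded_linear_Im] by simp
qed

lemma tendsto_symmetric_integral_at_top:
  fixes f :: "real \<Rightarrow> complex"
  assumes "integrable lborel f"
  shows "((\<lambda>t. \<integral>x. indicator {-t..t} x *\<^sub>R f x \<partial>lborel) \<longlongrightarrow> (\<integral>x. f x \<partial>lborel)) at_top"
proof (rule integral_dominated_convergence_at_top[where w = "\<lambda>x. cmod (f x)"])
  show "AE x in lborel. ((\<lambda>t. indicator {-t..t} x *\<^sub>R f x) \<longlongrightarrow> f x) at_top"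
  proof (rule AE_I2)
    fix x :: real
    have "eventually (\<lambda>t. indicator {-t..t} x *\<^sub>R f x = f x) at_top"
      using eventually_ge_at_top[of "\<bar>x\<bar>"] by eventually_elim (auto simp: indicator_def)
    then show "((\<lambda>t. indicator {-t..t} x *\<^sub>R f x) \<longlongrightarrow> f x) at_top"
      by (rule tendsto_eventually)
  qed
qed (use assms in \<open>auto simp: indicator_def\<close>)

section \<open>Holomorphic functions on a strip with bounded line integrals\<close>

text \<open>
  The integrals of \<open>\<bar>k\<bar>\<close> along the horizontal lines of a strip are bounded by one constant.
  Squares of Hardy functions and products of a Hardy function with a reflected one are of this kind,
  and two facts about them carry the proof: they are bounded on narrower strips, and their integral
  along a line does not depend on the line. Both are read off from primitives \<open>\<Phi>' = k\<close> and
  \<open>\<Phi>2' = \<Phi>\<close>, which exist because the strip is convex. By the \<open>L\<^sup>1\<close> bound \<open>\<Phi>\<close>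
  changes by at most \<open>C\<close> along any horizontal segment, whatever its length. Vertical differences
  are reached through \<open>\<Phi>2\<close>: the derivative of \<open>\<Phi>2 (z + T) - \<Phi>2 z\<close> is a horizontal increment of \<open>\<Phi>\<close>,
  hence at most \<open>C\<close>.
\<close>

locale L1_bounded_on_strip =
  fixes k :: "complex \<Rightarrow> complex" and a b C :: real
  assumes holo: "k holomorphic_on strip a b"
    and integrable_line: "\<And>y. a < y \<Longrightarrow> y < b \<Longrightarrow> integrable lborel (\<lambda>x. k (Complex x y))"
    and L1_bound: "\<And>y. a < y \<Longrightarrow> y < b \<Longrightarrow> (\<integral>x. cmod (k (Complex x y)) \<partial>lborel) \<le> C"
begin

lemma double_primitive:
  obtains \<Phi> \<Phi>2 where
    "\<And>z. z \<in> strip a b \<Longrightarrow> (\<Phi> has_field_derivative k z) (at z)"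
    "\<And>z. z \<in> strip a b \<Longrightarrow> (\<Phi>2 has_field_derivative \<Phi> z) (at z)"
proof -
  have *: "\<exists>g. \<forall>x\<in>strip a b. (g has_field_derivative f x) (at x)" if "f holomorphic_on strip a b" for f
    using holomorphic_convex_primitive'[OF convex_strip open_strip that]
    by (metis at_within_open[OF _ open_strip])
  from *[OF holo] obtain \<Phi> where \<Phi>: "\<And>x. x \<in> strip a b \<Longrightarrow> (\<Phi> has_field_derivative k x) (at x)"
    by auto
  then have "\<Phi> holomorphic_on strip a b"
    using holomorphic_on_open[OF open_strip] by blast
  from *[OF this] \<Phi> that show thesis by blast
qed

lemma primitive_horizontal_increment:
  assumes \<Phi>: "\<And>z. z \<in> strip a b \<Longrightarrow> (\<Phi> has_field_derivative k z) (at z)"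
    and y: "a < y" "y < b" and "s \<le> t"
  shows "\<Phi> (Complex t y) - \<Phi> (Complex s y) = (\<integral>x. indicator {s..t} x *\<^sub>R k (Complex x y) \<partial>lborel)"
    and "cmod (\<Phi> (Complex t y) - \<Phi> (Complex s y)) \<le> C"
proof -
  show eq: "\<Phi> (Complex t y) - \<Phi> (Complex s y) = (\<integral>x. indicator {s..t} x *\<^sub>R k (Complex x y) \<partial>lborel)"
    by (rule integral_over_horizontal_segment[OF \<open>s \<le> t\<close>, symmetric])
       (use y in \<open>auto intro!: \<Phi> continuous_on_horizontal_line[OF holo] simp: strip_def\<close>)
  have "cmod (\<integral>x. indicator {s..t} x *\<^sub>R k (Complex x y) \<partial>lborel) \<le> (\<integral>x. cmod (k (Complex x y)) \<partial>lborel)"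
    by (intro order_trans[OF integral_norm_bound integral_mono] integrable_mult_indicator integrable_norm integrable_line y)
       (auto simp: indicator_def)
  with L1_bound[OF y] show "cmod (\<Phi> (Complex t y) - \<Phi> (Complex s y)) \<le> C"
    by (simp add: eq)
qed

lemma primitive_increment_bound:
  assumes "\<And>z. z \<in> strip a b \<Longrightarrow> (\<Phi> has_field_derivative k z) (at z)"
    and "w \<in> strip a b" "0 \<le> t"
  shows "cmod (\<Phi> (w + of_real t) - \<Phi> w) \<le> C"
proof -
  have "w = Complex (Re w) (Im w)" "w + of_real t = Complex (Re w + t) (Im w)"
    by (simp_all add: complex_eq_iff)
  with primitive_horizontal_increment(2)[OF assms(1), of "Im w" "Re w" "Re w + t"] assms(2,3)
  show ?thesis by (simp add: strip_def)
qed

lemma L1_bound_nonneg: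
  assumes "a < b" shows "0 \<le> C"
proof -
  have "0 \<le> (\<integral>x. cmod (k (Complex x ((a+b)/2))) \<partial>lborel)" by simp
  also have "\<dots> \<le> C" using assms by (intro L1_bound) auto
  finally show ?thesis .
qed

text \<open>
  The unit average \<open>\<Phi>2 (w + 1) - \<Phi>2 w\<close> of \<open>\<Phi>\<close> stays within \<open>C\<close> of \<open>\<Phi> w\<close> and is Lipschitz with
  constant \<open>C\<close>. So \<open>\<Phi>\<close> oscillates by at most \<open>C (2 + r)\<close> on a disc of radius \<open>r\<close>, and Cauchy's
  inequality bounds its derivative \<open>k\<close> at the centre.
\<close>

lemma pointwise_bound:
  assumes r: "0 < r" and z: "a < Im z - r" "Im z + r < b"
  shows "cmod (k z) \<le> C * (2 + r) / r"
proof -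
  obtain \<Phi> \<Phi>2 where \<Phi>: "\<And>z. z \<in> strip a b \<Longrightarrow> (\<Phi> has_field_derivative k z) (at z)"
    and \<Phi>2: "\<And>z. z \<in> strip a b \<Longrightarrow> (\<Phi>2 has_field_derivative \<Phi> z) (at z)"
    using double_primitive by blast
  have C: "0 \<le> C" using L1_bound_nonneg r z by simp
  have incr: "cmod (\<Phi> (w + of_real t) - \<Phi> w) \<le> C" if "w \<in> strip a b" "0 \<le> t" for w t
    using primitive_increment_bound[OF \<Phi> that] .
  \<comment> \<open>mean value bound for \<open>\<Phi>2 v - v \<Phi> w\<close>, whose derivative is \<open>\<Phi> v - \<Phi> w\<close>, on the segment from \<open>w\<close> to \<open>w + 1\<close>\<close>
  have near: "cmod ((\<Phi>2 (w + 1) - \<Phi>2 w) - \<Phi> w) \<le> C" if w: "w \<in> strip a b" for w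
  proof -
    have "cmod ((\<Phi>2 (w + 1) - (w + 1) * \<Phi> w) - (\<Phi>2 w - w * \<Phi> w)) \<le> C * cmod ((w + 1) - w)"
    proof (rule field_differentiable_bound[where S = "closed_segment w (w + 1)" and f' = "\<lambda>v. \<Phi> v - \<Phi> w"])
      fix v assume "v \<in> closed_segment w (w + 1)"
      then obtain u where u: "0 \<le> u" "v = w + of_real u"
        by (auto simp: in_segment scaleR_conv_of_real algebra_simps)
      then have "v \<in> strip a b" using w by (simp add: strip_def)
      then show "((\<lambda>v. \<Phi>2 v - v * \<Phi> w) has_field_derivative \<Phi> v - \<Phi> w) (at v within closed_segment w (w + 1))"
        by (auto intro!: derivative_eq_intros has_field_derivative_at_within[OF \<Phi>2])
      show "cmod (\<Phi> v - \<Phi> w) \<le> C" using incr[OF w u(1)] u(2) by simp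
    qed auto
    then show ?thesis by (simp add: algebra_simps)
  qed
  have cb: "cball z r \<subseteq> strip a b"
  proof
    fix w assume "w \<in> cball z r"
    then have "\<bar>Im (z - w)\<bar> \<le> r" using abs_Im_le_cmod[of "z - w"] by (simp add: dist_norm)
    then show "w \<in> strip a b" using z by (auto simp: strip_def)
  qed
  have lip: "cmod ((\<Phi>2 (w + 1) - \<Phi>2 w) - (\<Phi>2 (z + 1) - \<Phi>2 z)) \<le> C * cmod (w - z)" if "w \<in> cball z r" for w
  proof (rule field_differentiable_bound[where S = "cball z r" and f' = "\<lambda>v. \<Phi> (v + 1) - \<Phi> v"])
    fix v assume "v \<in> cball z r"
    then have v: "v \<in> strip a b" using cb by auto
    then have v1: "v + 1 \<in> strip a b" by (simp add: strip_def)
    show "((\<lambda>w. \<Phi>2 (w + 1) - \<Phi>2 w) has_field_derivative \<Phi> (v + 1) - \<Phi> v) (at v within cball z r)"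
      by (rule has_field_derivative_at_within)
         (use DERIV_shift[of \<Phi>2 "\<Phi> (v+1)" v 1] \<Phi>2[OF v] \<Phi>2[OF v1] in \<open>auto intro!: derivative_eq_intros\<close>)
    show "cmod (\<Phi> (v + 1) - \<Phi> v) \<le> C" using incr[OF v, of 1] by simp
  qed (use that r in auto)
  have bound: "cmod (\<Phi> w - \<Phi> z) \<le> C * (2 + r)" if w: "norm (z - w) = r" for w
  proof -
    have "w \<in> cball z r" using w by (simp add: dist_norm)
    with near[of w] near[of z] lip[of w] cb r
    have "cmod (\<Phi>2 (w + 1) - \<Phi>2 w - \<Phi> w) \<le> C" "cmod (\<Phi>2 (z + 1) - \<Phi>2 z - \<Phi> z) \<le> C"
       "cmod ((\<Phi>2 (w + 1) - \<Phi>2 w) - (\<Phi>2 (z + 1) - \<Phi>2 z)) \<le> C * r"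
      using w by (auto simp: norm_minus_commute subset_iff)
    moreover have "\<Phi> w - \<Phi> z = ((\<Phi>2 (w + 1) - \<Phi>2 w) - (\<Phi>2 (z + 1) - \<Phi>2 z))
        - (\<Phi>2 (w + 1) - \<Phi>2 w - \<Phi> w) + (\<Phi>2 (z + 1) - \<Phi>2 z - \<Phi> z)" by simp
    ultimately have "cmod (\<Phi> w - \<Phi> z) \<le> C * r + C + C"
      by (smt (verit) norm_triangle_ineq norm_triangle_ineq4)
    then show ?thesis by (simp add: algebra_simps)
  qed
  have hol: "(\<lambda>w. \<Phi> w - \<Phi> z) holomorphic_on strip a b"
    using \<Phi> holomorphic_on_open[OF open_strip] by (intro holomorphic_intros) blast
  have "norm ((deriv ^^ 1) (\<lambda>w. \<Phi> w - \<Phi> z) z) \<le> fact 1 * (C * (2 + r)) / r ^ 1"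
    by (rule Cauchy_inequality)
       (use hol cb r bound order_trans[OF ball_subset_cball cb] in
         \<open>auto intro: holomorphic_on_subset holomorphic_on_imp_continuous_on\<close>)
  moreover have "((\<lambda>w. \<Phi> w - \<Phi> z) has_field_derivative k z) (at z)"
    using \<Phi>[of z] subsetD[OF cb, of z] r by (auto intro!: derivative_eq_intros)
  then have "deriv (\<lambda>w. \<Phi> w - \<Phi> z) z = k z" by (rule DERIV_imp_deriv)
  ultimately show ?thesis by simp
qed

text \<open>
  The function \<open>\<Psi> T z = \<Phi>2 (z + T) - 2 \<Phi>2 z + \<Phi>2 (z - T)\<close> is the integral of
  \<open>\<Phi> (z + u) - \<Phi> (z - u)\<close> over \<open>0 \<le> u \<le> T\<close>, and these differences tend to the integral of \<open>k\<close>
  along the line through \<open>z\<close>; so \<open>\<Psi> T z / T\<close> tends to that integral. On the other hand \<open>\<Psi> T\<close> is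
  Lipschitz with constant \<open>2 C\<close>, uniformly in \<open>T\<close>, so that the limits for two lines agree.
\<close>

lemma line_integral_constant:
  assumes y1: "a < y1" "y1 < b" and y2: "a < y2" "y2 < b"
  shows "(\<integral>x. k (Complex x y1) \<partial>lborel) = (\<integral>x. k (Complex x y2) \<partial>lborel)"
proof -
  obtain \<Phi> \<Phi>2 where \<Phi>: "\<And>z. z \<in> strip a b \<Longrightarrow> (\<Phi> has_field_derivative k z) (at z)"
    and \<Phi>2: "\<And>z. z \<in> strip a b \<Longrightarrow> (\<Phi>2 has_field_derivative \<Phi> z) (at z)"
    using double_primitive by blast
  have incr: "cmod (\<Phi> (w + of_real t) - \<Phi> w) \<le> C" if "w \<in> strip a b" "0 \<le> t" for w t
    using primitive_increment_bound[OF \<Phi> that] .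
  have incr': "cmod (\<Phi> w - \<Phi> (w - of_real t)) \<le> C" if "w \<in> strip a b" "0 \<le> t" for w t
    using incr[of "w - of_real t" t] that by (simp add: strip_def)
  define \<Psi> where "\<Psi> T z = \<Phi>2 (z + of_real T) - 2 * \<Phi>2 z + \<Phi>2 (z - of_real T)" for T z
  have shift: "((\<lambda>w. \<Phi>2 (w + c)) has_field_derivative \<Phi> (v + c)) (at v)" if "v + c \<in> strip a b" for v c
    using \<Phi>2[OF that] by (simp add: DERIV_shift)
  have lip: "cmod (\<Psi> T (Complex 0 y1) - \<Psi> T (Complex 0 y2)) \<le> (2 * C) * cmod (Complex 0 y1 - Complex 0 y2)"
    if T: "0 \<le> T" for T
  proof (rule field_differentiable_bound[OF convex_strip,
        where f' = "\<lambda>v. \<Phi> (v + of_real T) - 2 * \<Phi> v + \<Phi> (v - of_real T)"])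
    fix v assume v: "v \<in> strip a b"
    have vT: "v + of_real T \<in> strip a b" "v + (- of_real T) \<in> strip a b" using v by (auto simp: strip_def)
    have "((\<lambda>z. \<Phi>2 (z + of_real T) - 2 * \<Phi>2 z + \<Phi>2 (z + (- of_real T))) has_field_derivative
        \<Phi> (v + of_real T) - 2 * \<Phi> v + \<Phi> (v + (- of_real T))) (at v)"
      by (intro derivative_intros shift vT \<Phi>2[OF v] DERIV_cmult)
    then show "(\<Psi> T has_field_derivative \<Phi> (v + of_real T) - 2 * \<Phi> v + \<Phi> (v - of_real T)) (at v within strip a b)"
      unfolding \<Psi>_def by (simp add: has_field_derivative_at_within)
    have "\<Phi> (v + of_real T) - 2 * \<Phi> v + \<Phi> (v - of_real T) =
       (\<Phi> (v + of_real T) - \<Phi> v) - (\<Phi> v - \<Phi> (v - of_real T))" by simp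
    also have "cmod \<dots> \<le> C + C"
      using incr[OF v T] incr'[OF v T] norm_triangle_ineq4 by (smt (verit))
    finally show "cmod (\<Phi> (v + of_real T) - 2 * \<Phi> v + \<Phi> (v - of_real T)) \<le> 2 * C" by simp
  qed (use y1 y2 in \<open>auto simp: strip_def\<close>)
  have mean: "((\<lambda>T. \<Psi> T (Complex 0 y) / of_real T) \<longlongrightarrow> (\<integral>x. k (Complex x y) \<partial>lborel)) at_top"
    if y: "a < y" "y < b" for y
  proof (rule cesaro_of_derivative)
    fix t :: real assume "0 < t"
    have in_strip: "Complex 0 y + of_real t \<in> strip a b" "Complex 0 y - of_real t \<in> strip a b" 
      using y by (auto simp: strip_def)
    have "((\<lambda>T. Complex 0 y + of_real T) has_vector_derivative 1) (at t)"
         "((\<lambda>T. Complex 0 y - of_real T) has_vector_derivative -1) (at t)"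
      by (auto intro!: derivative_eq_intros)
    from field_vector_diff_chain_at[OF this(1) \<Phi>2[OF in_strip(1)]]
         field_vector_diff_chain_at[OF this(2) \<Phi>2[OF in_strip(2)]]
    show "((\<lambda>T. \<Psi> T (Complex 0 y)) has_vector_derivative
        (\<integral>x. indicator {-t..t} x *\<^sub>R k (Complex x y) \<partial>lborel)) (at t)"
      unfolding \<Psi>_def primitive_horizontal_increment(1)[OF \<Phi> y, of "-t" t, symmetric, simplified]
      using \<open>0 < t\<close> primitive_horizontal_increment(1)[OF \<Phi> y, of "-t" t, symmetric]
      by (auto intro!: derivative_eq_intros simp: o_def Complex_eq algebra_simps)
  next
    show "((\<lambda>t. \<integral>x. indicator {-t..t} x *\<^sub>R k (Complex x y) \<partial>lborel) \<longlongrightarrow> (\<integral>x. k (Complex x y) \<partial>lborel)) at_top"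
      by (rule tendsto_symmetric_integral_at_top[OF integrable_line[OF y]])
  qed
  have "((\<lambda>T. (\<Psi> T (Complex 0 y1) - \<Psi> T (Complex 0 y2)) / of_real T) \<longlongrightarrow> 0) at_top"
  proof (rule Lim_null_comparison)
    show "\<forall>\<^sub>F T in at_top. cmod ((\<Psi> T (Complex 0 y1) - \<Psi> T (Complex 0 y2)) / of_real T)
        \<le> ((2 * C) * cmod (Complex 0 y1 - Complex 0 y2)) / T"
      using eventually_gt_at_top[of 0]
      by eventually_elim (use lip in \<open>auto simp: norm_divide divide_right_mono\<close>)
    show "((\<lambda>T. ((2 * C) * cmod (Complex 0 y1 - Complex 0 y2)) / T) \<longlongrightarrow> 0) at_top"
      by (intro tendsto_divide_0[OF tendsto_const] filterlim_at_top_imp_at_infinity filterlim_ident)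
  qed
  moreover have "((\<lambda>T. (\<Psi> T (Complex 0 y1) - \<Psi> T (Complex 0 y2)) / of_real T) \<longlongrightarrow>
      (\<integral>x. k (Complex x y1) \<partial>lborel) - (\<integral>x. k (Complex x y2) \<partial>lborel)) at_top"
    using tendsto_diff[OF mean[OF y1] mean[OF y2]] by (simp add: diff_divide_distrib)
  ultimately show ?thesis
    using tendsto_unique[OF trivial_limit_at_top_linorder] by fastforce
qed

end

section \<open>The energy of Hardy functions on horizontal lines\<close>

definition line_energy :: "(complex \<Rightarrow> complex) \<Rightarrow> real \<Rightarrow> real" where
  "line_energy F y = (\<integral>x. (cmod (F (Complex x y)))\<^sup>2 \<partial>lborel)"

lemma upper_half_plane_shift: "0 \<le> d \<Longrightarrow> z \<in> upper_half_plane \<Longrightarrow> z + \<i> * of_real d \<in> upper_half_plane"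
  by (simp add: upper_half_plane_def)

lemma borel_measurable_line:
  assumes "F holomorphic_on upper_half_plane" "0 < y"
  shows "(\<lambda>x. F (Complex x y)) \<in> borel_measurable borel"
  by (rule borel_measurable_horizontal_line[OF assms(1)]) (use assms(2) in \<open>simp add: upper_half_plane_def\<close>)

lemma borel_measurable_cnj: "cnj \<in> borel_measurable borel"
  by (intro borel_measurable_continuous_onI continuous_intros)

lemma H2_iff:
  "F \<in> H2 \<longleftrightarrow> F holomorphic_on upper_half_plane \<and>
    (\<exists>C\<ge>0. \<forall>y>0. integrable lborel (\<lambda>x. (cmod (F (Complex x y)))\<^sup>2) \<and> line_energy F y \<le> C)"
  (is "_ \<longleftrightarrow> ?hol \<and> ?bdd")
proof (cases ?hol)
  case True
  have "hardy_norm_sq F < \<infinity> \<longleftrightarrow> ?bdd"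
  proof
    assume fin: "hardy_norm_sq F < \<infinity>"
    show ?bdd
    proof (intro exI[of _ "enn2real (hardy_norm_sq F)"] conjI allI impI)
      fix y :: real assume y: "0 < y"
      have le: "(\<integral>\<^sup>+x. ennreal ((cmod (F (Complex x y)))\<^sup>2) \<partial>lborel) \<le> hardy_norm_sq F"
        unfolding hardy_norm_sq_def by (rule SUP_upper) (use y in simp)
      then have int: "(\<integral>\<^sup>+x. ennreal ((cmod (F (Complex x y)))\<^sup>2) \<partial>lborel) < \<infinity>"
        using fin by (rule le_less_trans)
      then show I: "integrable lborel (\<lambda>x. (cmod (F (Complex x y)))\<^sup>2)"
        using borel_measurable_line[OF True y] by (intro integrableI_bounded) auto
      have "ennreal (line_energy F y) \<le> hardy_norm_sq F"
        using le nn_integral_eq_integral[OF I] by (simp add: line_energy_def)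
      then show "line_energy F y \<le> enn2real (hardy_norm_sq F)"
        using fin by (cases "hardy_norm_sq F") auto
    qed simp
  next
    assume ?bdd
    then obtain C where C: "0 \<le> C" "\<And>y. y > 0 \<Longrightarrow> integrable lborel (\<lambda>x. (cmod (F (Complex x y)))\<^sup>2)"
      "\<And>y. y > 0 \<Longrightarrow> line_energy F y \<le> C" by blast
    have "hardy_norm_sq F \<le> ennreal C"
      unfolding hardy_norm_sq_def
      by (rule SUP_least) (use C in \<open>auto simp: nn_integral_eq_integral line_energy_def intro!: ennreal_leI\<close>)
    then show "hardy_norm_sq F < \<infinity>" by (simp add: le_less_trans)
  qed
  then show ?thesis using True by (simp add: H2_def)
qed (simp add: H2_def)

lemma H2_holomorphic: "F \<in> H2 \<Longrightarrow> F holomorphic_on upper_half_plane"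
  by (simp add: H2_def)

lemma H2_integrable: "F \<in> H2 \<Longrightarrow> 0 < y \<Longrightarrow> integrable lborel (\<lambda>x. (cmod (F (Complex x y)))\<^sup>2)"
  unfolding H2_iff by blast

lemma H2_energy_bounded:
  assumes "F \<in> H2" obtains C where "0 \<le> C" "\<And>y. 0 < y \<Longrightarrow> line_energy F y \<le> C"
  using assms unfolding H2_iff by blast

lemma hardy_norm_sq_le:
  assumes "F \<in> H2" "\<And>y. 0 < y \<Longrightarrow> line_energy F y \<le> C"
  shows "hardy_norm_sq F \<le> ennreal C"
  unfolding hardy_norm_sq_def
  by (rule SUP_least)
     (use assms H2_integrable in \<open>auto simp: nn_integral_eq_integral line_energy_def intro!: ennreal_leI\<close>)

lemma norm_diff_sq_le: "(cmod (u - v))\<^sup>2 \<le> 2 * (cmod u)\<^sup>2 + 2 * (cmod v)\<^sup>2"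
proof -
  have "(cmod (u - v))\<^sup>2 + (cmod (u + v))\<^sup>2 = 2 * (cmod u)\<^sup>2 + 2 * (cmod v)\<^sup>2"
    by (simp only: cmod_power2) (simp add: power2_eq_square algebra_simps)
  then show ?thesis by (smt (verit) zero_le_power2)
qed

lemma H2_diff:
  assumes F: "F \<in> H2" and G: "G \<in> H2"
  shows "(\<lambda>z. F z - G z) \<in> H2"
    and "0 < y \<Longrightarrow> line_energy (\<lambda>z. F z - G z) y \<le> 2 * line_energy F y + 2 * line_energy G y"
proof -
  have hol: "(\<lambda>z. F z - G z) holomorphic_on upper_half_plane"
    using F G by (intro holomorphic_intros H2_holomorphic)
  have int: "integrable lborel (\<lambda>x. (cmod (F (Complex x y) - G (Complex x y)))\<^sup>2)" if "0 < y" for y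
  proof (rule Bochner_Integration.integrable_bound)
    show "integrable lborel (\<lambda>x. 2 * (cmod (F (Complex x y)))\<^sup>2 + 2 * (cmod (G (Complex x y)))\<^sup>2)"
      using H2_integrable[OF F that] H2_integrable[OF G that] by simp
    show "(\<lambda>x. (cmod (F (Complex x y) - G (Complex x y)))\<^sup>2) \<in> borel_measurable lborel"
      using borel_measurable_line[OF hol that] by simp
  qed (use norm_diff_sq_le in auto)
  have le: "line_energy (\<lambda>z. F z - G z) y \<le> 2 * line_energy F y + 2 * line_energy G y" if "0 < y" for y
  proof -
    have "line_energy (\<lambda>z. F z - G z) y \<le>
        (\<integral>x. 2 * (cmod (F (Complex x y)))\<^sup>2 + 2 * (cmod (G (Complex x y)))\<^sup>2 \<partial>lborel)"
      unfolding line_energy_def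
      by (intro integral_mono int that norm_diff_sq_le)
         (use H2_integrable[OF F that] H2_integrable[OF G that] in simp)
    then show ?thesis
      unfolding line_energy_def using H2_integrable[OF F that] H2_integrable[OF G that] by simp
  qed
  then show "0 < y \<Longrightarrow> line_energy (\<lambda>z. F z - G z) y \<le> 2 * line_energy F y + 2 * line_energy G y" .
  obtain C D where "0 \<le> C" "\<And>y. 0 < y \<Longrightarrow> line_energy F y \<le> C" "0 \<le> D" "\<And>y. 0 < y \<Longrightarrow> line_energy G y \<le> D"
    using H2_energy_bounded[OF F] H2_energy_bounded[OF G] by metis
  then have "0 \<le> 2 * C + 2 * D \<and> (\<forall>y>0. line_energy (\<lambda>z. F z - G z) y \<le> 2 * C + 2 * D)"
    using le by (smt (verit))
  then show "(\<lambda>z. F z - G z) \<in> H2"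
    unfolding H2_iff using hol int by blast
qed

lemma H2_mult_contraction:
  assumes F: "F \<in> H2" and g: "g holomorphic_on upper_half_plane"
    and le: "\<And>z. z \<in> upper_half_plane \<Longrightarrow> cmod (g z) \<le> 1"
  shows "(\<lambda>z. F z * g z) \<in> H2"
proof -
  have hol: "(\<lambda>z. F z * g z) holomorphic_on upper_half_plane"
    by (intro holomorphic_intros H2_holomorphic[OF F] g)
  have bd: "(cmod (F (Complex x y) * g (Complex x y)))\<^sup>2 \<le> (cmod (F (Complex x y)))\<^sup>2" if "0 < y" for x y
    using le[of "Complex x y"] that
    by (intro power_mono) (auto simp: norm_mult upper_half_plane_def intro: mult_left_le)
  have int: "integrable lborel (\<lambda>x. (cmod (F (Complex x y) * g (Complex x y)))\<^sup>2)" if "0 < y" for y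
    by (rule Bochner_Integration.integrable_bound[OF H2_integrable[OF F that]])
       (use borel_measurable_line[OF hol that] bd[OF that] in auto)
  obtain C where C: "0 \<le> C" "\<And>y. 0 < y \<Longrightarrow> line_energy F y \<le> C" using H2_energy_bounded[OF F] by blast
  have "line_energy (\<lambda>z. F z * g z) y \<le> C" if "0 < y" for y
  proof -
    have "line_energy (\<lambda>z. F z * g z) y \<le> line_energy F y"
      unfolding line_energy_def by (intro integral_mono int H2_integrable[OF F] that bd)
    with C(2)[OF that] show ?thesis by simp
  qed
  then show ?thesis unfolding H2_iff using hol int C(1) by blast
qed

lemma line_energy_shift: "line_energy (\<lambda>z. F (z + \<i> * of_real d)) y = line_energy F (y + d)"
proof -
  have "Complex x y + \<i> * of_real d = Complex x (y + d)" for x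
    by (simp add: complex_eq_iff)
  then show ?thesis by (simp add: line_energy_def)
qed

lemma H2_shift:
  assumes F: "F \<in> H2" and d: "0 \<le> d"
  shows "(\<lambda>z. F (z + \<i> * of_real d)) \<in> H2"
proof -
  have "F \<circ> (\<lambda>z. z + \<i> * of_real d) holomorphic_on upper_half_plane"
    by (rule holomorphic_on_compose_gen[OF _ H2_holomorphic[OF F]])
       (use d upper_half_plane_shift in \<open>auto intro!: holomorphic_intros\<close>)
  then have hol: "(\<lambda>z. F (z + \<i> * of_real d)) holomorphic_on upper_half_plane" by (simp add: o_def)
  have "Complex x y + \<i> * of_real d = Complex x (y + d)" for x y
    by (simp add: complex_eq_iff)
  then have "integrable lborel (\<lambda>x. (cmod (F (Complex x y + \<i> * of_real d)))\<^sup>2)" if "0 < y" for y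
    using H2_integrable[OF F, of "y + d"] that d by simp
  moreover obtain C where "0 \<le> C" "\<And>y. 0 < y \<Longrightarrow> line_energy F y \<le> C" using H2_energy_bounded[OF F] by blast
  ultimately show ?thesis unfolding H2_iff line_energy_shift using hol d by (metis add_pos_nonneg)
qed

section \<open>Convexity and monotonicity of the energy\<close>

text \<open>
  The square of a Hardy function has bounded \<open>L\<^sup>1\<close> norms on lines, so \<open>pointwise_bound\<close> applies to
  it; the disc of radius \<open>d / 2\<close> stays inside the half plane.
\<close>

lemma H2_bounded_above_line:
  assumes F: "F \<in> H2" and d: "0 < d"
  obtains B where "\<And>z. d \<le> Im z \<Longrightarrow> cmod (F z) \<le> B"
proof -
  obtain C where C: "0 \<le> C" "\<And>y. 0 < y \<Longrightarrow> line_energy F y \<le> C" using H2_energy_bounded[OF F] by blast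
  have "cmod (F z) \<le> sqrt (C * (2 + d/2) / (d/2))" if z: "d \<le> Im z" for z
  proof -
    interpret L1_bounded_on_strip "\<lambda>z. (F z)\<^sup>2" 0 "Im z + d" C
    proof
      show "(\<lambda>z. (F z)\<^sup>2) holomorphic_on strip 0 (Im z + d)"
        by (intro holomorphic_intros holomorphic_on_subset[OF H2_holomorphic[OF F]])
           (auto simp: strip_def upper_half_plane_def)
      fix y :: real assume y: "0 < y"
      show "integrable lborel (\<lambda>x. (F (Complex x y))\<^sup>2)"
        by (rule Bochner_Integration.integrable_bound[OF H2_integrable[OF F y]])
           (use borel_measurable_line[OF H2_holomorphic[OF F] y] in \<open>auto simp: norm_power\<close>)
      show "(\<integral>x. cmod ((F (Complex x y))\<^sup>2) \<partial>lborel) \<le> C"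
        using C(2)[OF y] by (simp add: line_energy_def norm_power)
    qed
    have "(cmod (F z))\<^sup>2 \<le> C * (2 + d/2) / (d/2)"
      using pointwise_bound[of "d/2" z] z d by (simp add: norm_power)
    then show ?thesis by (rule real_le_rsqrt)
  qed
  with that show thesis by blast
qed

text \<open>
  The function \<open>F z * cnj (F (cnj z + \<i> (a + b)))\<close> is holomorphic on the strip \<open>0 < Im z < a + b\<close>.
  Its integral along the line at height \<open>a\<close> is the inner product of the traces of \<open>F\<close> at the heights
  \<open>a\<close> and \<open>b\<close>, and along the middle line it is the energy there. As these are equal,
  inner products between lines are known, and with them the distances between traces.
\<close>

lemma H2_parallelogram:
  assumes F: "F \<in> H2" and a: "0 < a" and b: "0 < b"
  shows "(\<integral>x. (cmod (F (Complex x a) - F (Complex x b)))\<^sup>2 \<partial>lborel) =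
    line_energy F a + line_energy F b - 2 * line_energy F ((a + b) / 2)"
proof -
  define F' where "F' z = cnj (F (cnj z + \<i> * of_real (a + b)))" for z
  define k where "k z = F z * F' z" for z
  have F'_line: "F' (Complex x y) = cnj (F (Complex x (a + b - y)))" for x y
  proof -
    have "cnj (Complex x y) + \<i> * of_real (a + b) = Complex x (a + b - y)" by (simp add: complex_eq_iff)
    then show ?thesis by (simp only: F'_def)
  qed
  obtain C where C: "0 \<le> C" "\<And>y. 0 < y \<Longrightarrow> line_energy F y \<le> C" using H2_energy_bounded[OF F] by blast
  have cross: "integrable lborel (\<lambda>x. F (Complex x s) * cnj (F (Complex x t)))"
    "(\<integral>x. cmod (F (Complex x s) * cnj (F (Complex x t))) \<partial>lborel) \<le> C" if s: "0 < s" and t: "0 < t" for s t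
  proof -
    have bd: "cmod (F (Complex x s) * cnj (F (Complex x t))) \<le>
        (cmod (F (Complex x s)))\<^sup>2 / 2 + (cmod (F (Complex x t)))\<^sup>2 / 2" for x
      using sum_squares_bound[of "cmod (F (Complex x s))" "cmod (F (Complex x t))"] by (simp add: norm_mult)
    have int: "integrable lborel (\<lambda>x. (cmod (F (Complex x s)))\<^sup>2 / 2 + (cmod (F (Complex x t)))\<^sup>2 / 2)"
      using H2_integrable[OF F s] H2_integrable[OF F t] by simp
    show I: "integrable lborel (\<lambda>x. F (Complex x s) * cnj (F (Complex x t)))"
      by (rule Bochner_Integration.integrable_bound[OF int])
         (use bd borel_measurable_line[OF H2_holomorphic[OF F] s]
            measurable_compose[OF borel_measurable_line[OF H2_holomorphic[OF F] t] borel_measurable_cnj] in auto)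
    have "(\<integral>x. cmod (F (Complex x s) * cnj (F (Complex x t))) \<partial>lborel) \<le>
        (\<integral>x. (cmod (F (Complex x s)))\<^sup>2 / 2 + (cmod (F (Complex x t)))\<^sup>2 / 2 \<partial>lborel)"
      by (intro integral_mono integrable_norm I int bd)
    also have "\<dots> = line_energy F s / 2 + line_energy F t / 2"
      using H2_integrable[OF F s] H2_integrable[OF F t] by (simp add: line_energy_def)
    finally show "(\<integral>x. cmod (F (Complex x s) * cnj (F (Complex x t))) \<partial>lborel) \<le> C"
      using C(2)[OF s] C(2)[OF t] by simp
  qed
  interpret L1_bounded_on_strip k 0 "a + b" C
  proof
    have eq: "F' = cnj \<circ> (\<lambda>z. F (z + \<i> * of_real (a + b))) \<circ> cnj"
      by (simp add: F'_def fun_eq_iff)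
    have "F' holomorphic_on strip 0 (a + b)"
      unfolding eq
    proof (rule holomorphic_on_compose_cnj_cnj[OF _ open_strip])
      have "F \<circ> (\<lambda>z. z + \<i> * of_real (a + b)) holomorphic_on cnj ` strip 0 (a + b)"
        by (rule holomorphic_on_compose_gen[OF _ H2_holomorphic[OF F]])
           (auto intro!: holomorphic_intros simp: strip_def upper_half_plane_def)
      then show "(\<lambda>z. F (z + \<i> * of_real (a + b))) holomorphic_on cnj ` strip 0 (a + b)" by (simp add: o_def)
    qed
    then show "k holomorphic_on strip 0 (a + b)"
      unfolding k_def
      by (intro holomorphic_intros holomorphic_on_subset[OF H2_holomorphic[OF F]])
         (auto simp: strip_def upper_half_plane_def)
    fix y :: real assume "0 < y" "y < a + b"
    then show "integrable lborel (\<lambda>x. k (Complex x y))" "(\<integral>x. cmod (k (Complex x y)) \<partial>lborel) \<le> C"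
      unfolding k_def F'_line by (intro cross; simp)+
  qed
  have mid: "a + b - (a + b) / 2 = (a + b) / 2" by (simp add: field_simps)
  have "(\<integral>x. F (Complex x a) * cnj (F (Complex x b)) \<partial>lborel) = (\<integral>x. k (Complex x a) \<partial>lborel)"
    by (simp add: k_def F'_line)
  also have "\<dots> = (\<integral>x. k (Complex x ((a + b) / 2)) \<partial>lborel)"
    by (rule line_integral_constant) (use a b in auto)
  also have "\<dots> = (\<integral>x. of_real ((cmod (F (Complex x ((a + b) / 2))))\<^sup>2) \<partial>lborel)"
    unfolding k_def F'_line mid by (simp only: complex_norm_square)
  also have "\<dots> = of_real (line_energy F ((a + b) / 2))"
    unfolding line_energy_def by (rule integral_complex_of_real)
  finally have shift: "(\<integral>x. F (Complex x a) * cnj (F (Complex x b)) \<partial>lborel) = of_real (line_energy F ((a + b) / 2))" .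
  have expand: "(cmod (u - v))\<^sup>2 = (cmod u)\<^sup>2 + (cmod v)\<^sup>2 - 2 * Re (u * cnj v)" for u v
    by (simp only: cmod_power2) (simp add: power2_eq_square algebra_simps)
  define r where "r x = Re (F (Complex x a) * cnj (F (Complex x b)))" for x
  have "integrable lborel r"
    unfolding r_def[abs_def] by (rule integrable_Re[OF cross(1)[OF a b]])
  moreover have "(\<integral>x. r x \<partial>lborel) = line_energy F ((a + b) / 2)"
    unfolding r_def using integral_Re[OF cross(1)[OF a b]] shift by simp
  ultimately show ?thesis
    unfolding expand line_energy_def r_def[symmetric]
    using H2_integrable[OF F a] H2_integrable[OF F b] by simp
qed

text \<open>
  If \<open>M\<close> increased by \<open>e > 0\<close> over some step, midpoint convexity would force an increase of at least \<open>e\<close>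
  over each later step of that length, and \<open>M\<close> would be unbounded.
\<close>

lemma midpoint_convex_bounded_imp_antimono:
  fixes M :: "real \<Rightarrow> real"
  assumes mid: "\<And>s t. 0 < s \<Longrightarrow> 0 < t \<Longrightarrow> 2 * M ((s + t) / 2) \<le> M s + M t"
    and bdd: "\<And>s. 0 < s \<Longrightarrow> M s \<le> C"
    and s: "0 < s" "s \<le> t"
  shows "M t \<le> M s"
proof (rule ccontr)
  assume "\<not> M t \<le> M s"
  define e where "e = M t - M s"
  have e: "0 < e" using \<open>\<not> M t \<le> M s\<close> by (simp add: e_def)
  \<comment> \<open>samples of \<open>M\<close> along the arithmetic progression that starts with \<open>s\<close> and \<open>t\<close>\<close>
  define m where "m n = M (s + real n * (t - s))" for n
  have step: "m (Suc n) - m n \<ge> e" for n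
  proof (induction n)
    case 0 show ?case by (simp add: m_def e_def)
  next
    case (Suc n)
    have "(s + real n * (t - s) + (s + real (Suc (Suc n)) * (t - s))) / 2 = s + real (Suc n) * (t - s)"
      by (simp add: field_simps)
    moreover have "0 < s + real n * (t - s)" "0 < s + real (Suc (Suc n)) * (t - s)"
      using s by (auto intro!: add_pos_nonneg mult_nonneg_nonneg)
    ultimately have "2 * m (Suc n) \<le> m n + m (Suc (Suc n))"
      unfolding m_def using mid by metis
    with Suc show ?case by simp
  qed
  have "m 0 + real n * e \<le> m n" for n
  proof (induction n)
    case (Suc n)
    then show ?case using step[of n] by (simp add: algebra_simps)
  qed simp
  moreover obtain n where "real n * e > C - m 0"
    using reals_Archimedean3[OF e] by blast
  ultimately have "m n > C" by (smt (verit))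
  moreover have "m n \<le> C"
    unfolding m_def using s by (intro bdd add_pos_nonneg) auto
  ultimately show False by simp
qed

text \<open>
  Midpoint convexity of the energy is the nonnegativity of the left side of \<open>H2_parallelogram\<close>.
\<close>

lemma line_energy_antimono:
  assumes F: "F \<in> H2" and s: "0 < s" "s \<le> t"
  shows "line_energy F t \<le> line_energy F s"
proof -
  obtain C where C: "\<And>y. 0 < y \<Longrightarrow> line_energy F y \<le> C" using H2_energy_bounded[OF F] by blast
  show ?thesis
  proof (rule midpoint_convex_bounded_imp_antimono[OF _ C s])
    fix u v :: real assume u: "0 < u" and v: "0 < v"
    have "0 \<le> (\<integral>x. (cmod (F (Complex x u) - F (Complex x v)))\<^sup>2 \<partial>lborel)" by simp
    then show "2 * line_energy F ((u + v) / 2) \<le> line_energy F u + line_energy F v"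
      by (simp add: H2_parallelogram[OF F u v])
  qed
qed

text \<open>
  By \<open>H2_parallelogram\<close> the squared distance of two traces at low height is a second difference of the
  energy, which is small because the energy increases to its finite supremum \<open>S\<close> as the height
  tends to \<open>0\<close>. Lines further up need no separate estimate: the difference is itself in \<open>H\<^sup>2\<close>, so its energy
  decreases with the height.
\<close>

lemma line_energy_shift_diff_small:
  assumes F: "F \<in> H2" and e: "0 < e"
  obtains d where "0 < d" "\<And>y. 0 < y \<Longrightarrow> line_energy (\<lambda>z. F z - F (z + \<i> * of_real d)) y \<le> e"
proof -
  obtain C where C: "\<And>y. 0 < y \<Longrightarrow> line_energy F y \<le> C" using H2_energy_bounded[OF F] by blast
  define S where "S = (SUP y\<in>{0<..}. line_energy F y)"
  have bdd: "bdd_above (line_energy F ` {0<..})" using C by (intro bdd_aboveI2) auto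
  then have le_S: "line_energy F y \<le> S" if "0 < y" for y
    unfolding S_def using that by (intro cSUP_upper) auto
  have "S - e < S" using e by simp
  then obtain d where d: "0 < d" "S - e < line_energy F d"
    unfolding S_def using less_cSUP_iff[OF _ bdd] by auto
  \<comment> \<open>shifting by \<open>d / 2\<close> keeps a line at height at most \<open>d / 2\<close>, together with its shift, below height \<open>d\<close>\<close>
  define D where "D z = F z - F (z + \<i> * of_real (d / 2))" for z
  have D: "D \<in> H2"
    unfolding D_def using d by (intro H2_diff F H2_shift) auto
  have small: "line_energy D y \<le> e" if y: "0 < y" "y \<le> d / 2" for y
  proof -
    have "Complex x y + \<i> * of_real (d / 2) = Complex x (y + d / 2)" for x by (simp add: complex_eq_iff)
    then have "line_energy D y = (\<integral>x. (cmod (F (Complex x y) - F (Complex x (y + d / 2))))\<^sup>2 \<partial>lborel)"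
      by (simp add: line_energy_def D_def)
    also have "\<dots> = line_energy F y + line_energy F (y + d / 2) - 2 * line_energy F ((y + (y + d / 2)) / 2)"
      by (rule H2_parallelogram[OF F]) (use y d in auto)
    also have "\<dots> \<le> line_energy F y - line_energy F ((y + (y + d / 2)) / 2)"
      using line_energy_antimono[OF F, of "(y + (y + d / 2)) / 2" "y + d / 2"] y d by simp
    also have "\<dots> \<le> S - line_energy F d"
      using le_S[OF y(1)] line_energy_antimono[OF F, of "(y + (y + d / 2)) / 2" d] y d by simp
    finally show ?thesis using d by simp
  qed
  have "line_energy D y \<le> e" if "0 < y" for y
  proof (cases "y \<le> d / 2")
    case False
    then have "line_energy D y \<le> line_energy D (d / 2)" using d by (intro line_energy_antimono[OF D]) auto
    also have "\<dots> \<le> e" using d by (intro small) auto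
    finally show ?thesis .
  qed (use small that in auto)
  then show thesis using that[of "d / 2"] d unfolding D_def by simp
qed

section \<open>Approximation by bounded functions of decay \<open>1 / z\<close>\<close>

text \<open>
  These factors tend to \<open>1\<close> as \<open>n\<close> grows, and each decays like \<open>1 / z\<close>, the rate at which \<open>F_outer\<close> decays. A bounded
  function times a cutoff is therefore a bounded multiple of \<open>F_outer\<close>.
\<close>

definition cutoff :: "nat \<Rightarrow> complex \<Rightarrow> complex" where
  "cutoff n z = \<i> * of_nat n / (z + \<i> * of_nat n)"

lemma cutoff_complement_bound:
  assumes "0 < Im z"
  shows "cmod (1 - cutoff n z) \<le> 1"
proof -
  have nz: "z + \<i> * of_nat n \<noteq> 0" using assms by (auto simp: complex_eq_iff)
  then have eq: "1 - cutoff n z = z / (z + \<i> * of_nat n)"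
    by (simp add: cutoff_def field_simps)
  have "(cmod z)\<^sup>2 \<le> (cmod (z + \<i> * of_nat n))\<^sup>2"
    using assms by (simp only: cmod_power2) (simp add: power_mono)
  then have "cmod z \<le> cmod (z + \<i> * of_nat n)" by (rule power2_le_imp_le) simp
  then show ?thesis using nz unfolding eq by (simp add: norm_divide divide_le_eq)
qed

lemma cutoff_tendsto: "(\<lambda>n. cutoff n z) \<longlonglongrightarrow> 1"
proof -
  have "(\<lambda>n. 1 / (1 + z / (\<i> * of_nat n))) \<longlonglongrightarrow> 1 / (1 + 0)"
  proof (intro tendsto_intros)
    have "(\<lambda>n. (z / \<i>) / of_nat n) \<longlonglongrightarrow> 0"
      by (rule lim_const_over_n)
    then show "(\<lambda>n. z / (\<i> * of_nat n)) \<longlonglongrightarrow> 0" by (simp only: divide_divide_eq_left)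
  qed simp
  moreover have "\<forall>\<^sub>F n in sequentially. 1 / (1 + z / (\<i> * of_nat n)) = cutoff n z"
    using eventually_gt_at_top[of 0]
  proof eventually_elim
    case (elim n)
    then have "1 + z / (\<i> * of_nat n) = (z + \<i> * of_nat n) / (\<i> * of_nat n)" by (simp add: field_simps)
    then show ?case by (simp add: cutoff_def)
  qed
  ultimately show ?thesis using Lim_transform_eventually by fastforce
qed

lemma cutoff_holomorphic: "cutoff n holomorphic_on upper_half_plane"
  unfolding cutoff_def[abs_def]
  by (intro holomorphic_intros) (auto simp: upper_half_plane_def complex_eq_iff)

lemma line_energy_cutoff_small:
  assumes F: "F \<in> H2" and y: "0 < y" and e: "0 < e"
  obtains n where "0 < n" "line_energy (\<lambda>z. F z * (1 - cutoff n z)) y < e"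
proof -
  have "(\<lambda>n. \<integral>x. (cmod (F (Complex x y) * (1 - cutoff n (Complex x y))))\<^sup>2 \<partial>lborel) \<longlonglongrightarrow> (\<integral>x. 0 \<partial>(lborel :: real measure))"
  proof (rule integral_dominated_convergence[OF _ _ H2_integrable[OF F y]])
    show "AE x in lborel. (\<lambda>n. (cmod (F (Complex x y) * (1 - cutoff n (Complex x y))))\<^sup>2) \<longlonglongrightarrow> 0"
    proof (rule AE_I2)
      fix x
      have "(\<lambda>n. (cmod (F (Complex x y) * (1 - cutoff n (Complex x y))))\<^sup>2) \<longlonglongrightarrow> (cmod (F (Complex x y) * (1 - 1)))\<^sup>2"
        by (intro tendsto_intros cutoff_tendsto)
      then show "(\<lambda>n. (cmod (F (Complex x y) * (1 - cutoff n (Complex x y))))\<^sup>2) \<longlonglongrightarrow> 0" by simp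
    qed
    fix n
    have "(\<lambda>z. F z * (1 - cutoff n z)) holomorphic_on upper_half_plane"
      by (intro holomorphic_intros H2_holomorphic[OF F] cutoff_holomorphic)
    from borel_measurable_line[OF this y]
    show "(\<lambda>x. (cmod (F (Complex x y) * (1 - cutoff n (Complex x y))))\<^sup>2) \<in> borel_measurable lborel" by simp
    show "AE x in lborel. norm ((cmod (F (Complex x y) * (1 - cutoff n (Complex x y))))\<^sup>2) \<le> (cmod (F (Complex x y)))\<^sup>2"
      using cutoff_complement_bound[of "Complex x y" for x] y
      by (intro AE_I2) (auto simp: norm_mult intro!: power_mono mult_left_le)
  qed simp
  then have "(\<lambda>n. line_energy (\<lambda>z. F z * (1 - cutoff n z)) y) \<longlonglongrightarrow> 0" by (simp add: line_energy_def)
  then have "\<forall>\<^sub>F n in sequentially. line_energy (\<lambda>z. F z * (1 - cutoff n z)) y < e"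
    using e by (rule order_tendstoD)
  then have "\<forall>\<^sub>F n in sequentially. 0 < n \<and> line_energy (\<lambda>z. F z * (1 - cutoff n z)) y < e"
    using eventually_gt_at_top[of 0] by eventually_elim simp
  then show thesis using that eventually_happens'[OF sequentially_bot] by blast
qed

text \<open>
  Shifting upwards by \<open>d\<close> makes \<open>G\<close> bounded, and the cutoff provides decay. The
  cutoff is shifted along with \<open>G\<close>, so that the cutoff error is a shift of the single function
  \<open>G (1 - cutoff n)\<close>. Dominated convergence makes the energy of this function small at height \<open>d\<close>,
  hence on all lines above by monotonicity, and only these lines enter after the shift.
\<close>

lemma H2_approximation:
  assumes G: "G \<in> H2" and e: "0 < e"
  obtains n :: nat and d :: real where "0 < n" "0 < d"
    "hardy_norm_sq (\<lambda>z. G z - G (z + \<i> * of_real d) * cutoff n (z + \<i> * of_real d)) \<le> ennreal e"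
proof -
  obtain d where d: "0 < d" "\<And>y. 0 < y \<Longrightarrow> line_energy (\<lambda>z. G z - G (z + \<i> * of_real d)) y \<le> e / 4"
    using line_energy_shift_diff_small[OF G, of "e / 4"] e by auto
  obtain n where n: "0 < n" "line_energy (\<lambda>z. G z * (1 - cutoff n z)) d < e / 4"
    using line_energy_cutoff_small[OF G d(1), of "e / 4"] e by auto
  define A where "A z = G z - G (z + \<i> * of_real d)" for z
  define R where "R z = G z * (1 - cutoff n z)" for z
  define B where "B z = R (z + \<i> * of_real d)" for z
  have A: "A \<in> H2" unfolding A_def using d by (intro H2_diff G H2_shift) auto
  have R: "R \<in> H2" unfolding R_def
    by (intro H2_mult_contraction G holomorphic_intros cutoff_holomorphic cutoff_complement_bound)
       (simp add: upper_half_plane_def)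
  have B: "B \<in> H2" unfolding B_def using d by (intro H2_shift R) auto
  have B_le: "line_energy B y \<le> e / 4" if "0 < y" for y
    unfolding B_def line_energy_shift
    using line_energy_antimono[OF R, of d "y + d"] n(2) d that by (simp add: R_def[abs_def])
  \<comment> \<open>the error is the sum of \<open>A\<close> and \<open>B\<close>, each of energy at most \<open>e / 4\<close>; squaring the sum costs a factor \<open>2\<close>\<close>
  have "hardy_norm_sq (\<lambda>z. A z - (- 1) * B z) \<le> ennreal e"
  proof (rule hardy_norm_sq_le)
    have nB: "(\<lambda>z. B z * (- 1)) \<in> H2" by (intro H2_mult_contraction B holomorphic_intros) simp
    then show "(\<lambda>z. A z - (- 1) * B z) \<in> H2" using H2_diff(1)[OF A nB] by simp
    fix y :: real assume y: "0 < y"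
    have "line_energy (\<lambda>z. B z * (- 1)) y = line_energy B y" by (simp add: line_energy_def)
    then show "line_energy (\<lambda>z. A z - (- 1) * B z) y \<le> e"
      using H2_diff(2)[OF A nB y] d(2)[OF y] B_le[OF y] by (simp add: A_def[abs_def])
  qed
  also have "(\<lambda>z. A z - (- 1) * B z) = (\<lambda>z. G z - G (z + \<i> * of_real d) * cutoff n (z + \<i> * of_real d))"
    by (simp add: A_def B_def R_def algebra_simps fun_eq_iff)
  finally show thesis using that n(1) d(1) by blast
qed

section \<open>The Fourier transform of the Poisson kernel\<close>

lemma poisson_pos: "0 < l \<Longrightarrow> 0 < poisson l x"
  by (simp add: poisson_def add_pos_nonneg)

lemma continuous_on_poisson: "0 < l \<Longrightarrow> continuous_on A (poisson l)"
  unfolding poisson_def[abs_def]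
  by (intro continuous_intros) (smt (verit) zero_le_power2 zero_less_power)+

lemma has_bochner_integral_poisson:
  assumes l: "0 < l"
  shows "has_bochner_integral lborel (poisson l) 1"
proof -
  have lim: "((\<lambda>x. arctan (x / l) / pi) \<longlongrightarrow> 1 / 2) at_top"
  proof -
    have "((\<lambda>x. arctan (x / l) / pi) \<longlongrightarrow> (pi / 2) / pi) at_top"
      by (intro tendsto_intros filterlim_compose[OF tendsto_arctan_at_top])
         (use l in \<open>auto simp: divide_inverse intro!: filterlim_tendsto_pos_mult_at_top filterlim_ident
             filterlim_at_top_mult_tendsto_pos[OF tendsto_const]\<close>)
    then show ?thesis by simp
  qed
  have lim': "((\<lambda>x. arctan (x / l) / pi) \<longlongrightarrow> - (1 / 2)) at_bot"
    using tendsto_minus[OF lim] by (simp add: filterlim_at_bot_mirror arctan_minus)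
  have deriv: "DERIV (\<lambda>x. arctan (x / l) / pi) x :> poisson l x" for x
  proof -
    have eq: "1 + (x / l)\<^sup>2 = (l\<^sup>2 + x\<^sup>2) / l\<^sup>2" using l by (simp add: field_simps)
    have "DERIV (\<lambda>x. arctan (x / l) / pi) x :> inverse (1 + (x / l)\<^sup>2) * (1 / l) / pi"
      using l by (auto intro!: derivative_eq_intros)
    also have "inverse (1 + (x / l)\<^sup>2) * (1 / l) / pi = poisson l x"
      unfolding eq using l by (simp add: poisson_def power2_eq_square)
    finally show ?thesis .
  qed
  note ftc = interval_integral_FTC_nonneg[of "-\<infinity>" \<infinity> "\<lambda>x. arctan (x / l) / pi" "poisson l" "- (1/2)" "1/2"]
  have cont: "isCont (poisson l) x" for x
    using continuous_on_poisson[OF l, of UNIV] continuous_on_eq_continuous_at by blast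
  have "set_integrable lborel (einterval (-\<infinity>) \<infinity>) (poisson l)" "(LBINT x=-\<infinity>..\<infinity>. poisson l x) = 1"
    using ftc deriv cont lim lim' poisson_pos[OF l]
    by (auto simp: at_left_PInf at_right_MInf o_def filterlim_filtermap less_imp_le)
  then show ?thesis
    by (simp add: has_bochner_integral_iff set_integrable_def interval_lebesgue_integral_def
        set_lebesgue_integral_def einterval_def)
qed

lemmas integrable_poisson = integrable.intros[OF has_bochner_integral_poisson]
lemmas integral_poisson = has_bochner_integral_integral_eq[OF has_bochner_integral_poisson]

lemma integrable_exp_poisson:
  assumes "0 < l"
  shows "integrable lborel (\<lambda>x. exp (\<i> * of_real t * of_real x) * of_real (poisson l x))"
proof (rule Bochner_Integration.integrable_bound[OF integrable_poisson[OF assms]])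
  show "(\<lambda>x. exp (\<i> * of_real t * of_real x) * complex_of_real (poisson l x)) \<in> borel_measurable lborel"
    using assms by (auto intro!: borel_measurable_continuous_onI continuous_intros continuous_on_poisson)
qed (use poisson_pos[OF assms] in \<open>auto simp: norm_mult norm_exp_eq_Re\<close>)

text \<open>
  With \<open>f z = exp (\<i> t z)\<close> and \<open>a = \<i> l\<close>, the quotient \<open>g = (f - f a) / (z\<^sup>2 + l\<^sup>2)\<close> has a removable
  singularity at \<open>a\<close>, the only zero of the denominator in the closed upper half plane, and there \<open>\<bar>g\<bar>\<close> is
  at most \<open>2 / (R\<^sup>2 - l\<^sup>2)\<close> outside the disc of radius \<open>R > l\<close>, because \<open>t \<ge> 0\<close>. Its integral over
  \<open>[- R, R]\<close> equals the one along the other three sides of a box of height \<open>R\<close>, which tends to \<open>0\<close>. So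
  \<open>f\<close> and the constant \<open>f a = exp (- l t)\<close> have the same integral against the Poisson kernel,
  whose total mass is \<open>1\<close>. The integrals along the sides of the box appear as increments of a primitive
  \<open>\<Gamma>\<close> of \<open>g\<close>.
\<close>

lemma fourier_poisson_nonneg:
  assumes l: "0 < l" and t: "0 \<le> t"
  shows "(\<integral>x. exp (\<i> * of_real t * of_real x) * of_real (poisson l x) \<partial>lborel) = of_real (exp (- l * t))"
proof -
  define S where "S = {z. - l < Im z}"
  have S: "open S" "convex S"
    unfolding S_def by (auto simp: convex_halfspace_Im_gt intro!: open_Collect_less continuous_intros)
  define a where "a = \<i> * of_real l"
  define f where "f z = exp (\<i> * of_real t * z)" for z :: complex
  define h where "h z = (if z = a then deriv f a else (f z - f a) / (z - a))" for z
  define g where "g z = h z / (z + a)" for z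
  have fa: "f a = of_real (exp (- l * t))"
    by (simp add: f_def a_def exp_of_real[symmetric] mult_ac flip: of_real_mult of_real_minus)
  have "f holomorphic_on S" unfolding f_def by (intro holomorphic_intros)
  then have "h holomorphic_on S"
    unfolding h_def[abs_def] using pole_lemma_open[OF _ S(1)] by blast
  then have g: "g holomorphic_on S"
    unfolding g_def[abs_def]
    by (intro holomorphic_intros) (auto simp: S_def a_def complex_eq_iff)
  obtain \<Gamma> where \<Gamma>: "\<And>z. z \<in> S \<Longrightarrow> (\<Gamma> has_field_derivative g z) (at z)"
    using holomorphic_convex_primitive'[OF S(2,1) g] by (metis at_within_open[OF _ S(1)])
  have g_eq: "g z = (f z - f a) / (z\<^sup>2 + of_real (l\<^sup>2))" if "z \<noteq> a" for z
    using that by (simp add: g_def h_def a_def power2_eq_square algebra_simps)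
  have f_le: "cmod (f z) \<le> 1" if "0 \<le> Im z" for z
    using that t by (simp add: f_def norm_exp_eq_Re)
  have g_le: "cmod (g z) \<le> 2 / (R\<^sup>2 - l\<^sup>2)" if z: "0 \<le> Im z" "R \<le> cmod z" and R: "l < R" for z R
  proof -
    have "z \<noteq> a" using z R l by (auto simp: a_def norm_mult)
    have pos: "0 < R\<^sup>2 - l\<^sup>2" using R l by (simp add: power_strict_mono)
    have "R\<^sup>2 - l\<^sup>2 \<le> (cmod z)\<^sup>2 - l\<^sup>2" using z R l by (simp add: power_mono)
    also have "\<dots> \<le> cmod (z\<^sup>2 + of_real (l\<^sup>2))"
      using norm_diff_ineq[of "z\<^sup>2" "of_real (l\<^sup>2)"] by (simp add: norm_power)
    finally have den: "R\<^sup>2 - l\<^sup>2 \<le> cmod (z\<^sup>2 + of_real (l\<^sup>2))" .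
    have "cmod (f z - f a) \<le> 1 + 1"
      using norm_triangle_ineq4[of "f z" "f a"] f_le[OF z(1)] f_le[of a] l by (simp add: a_def)
    then show ?thesis
      unfolding g_eq[OF \<open>z \<noteq> a\<close>] norm_divide using den pos by (intro frac_le) auto
  qed
  have side: "cmod (\<Gamma> v - \<Gamma> w) \<le> 2 / (R\<^sup>2 - l\<^sup>2) * cmod (v - w)"
    if "convex T" "\<And>z. z \<in> T \<Longrightarrow> 0 \<le> Im z \<and> R \<le> cmod z" "v \<in> T" "w \<in> T" and R: "l < R" for T v w R
  proof (rule field_differentiable_bound[OF that(1), where f' = g])
    fix z assume "z \<in> T"
    with that(2) have z: "0 \<le> Im z" "R \<le> cmod z" by auto
    then have "z \<in> S" using l by (simp add: S_def)
    then show "(\<Gamma> has_field_derivative g z) (at z within T)" by (simp add: \<Gamma> has_field_derivative_at_within)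
    show "cmod (g z) \<le> 2 / (R\<^sup>2 - l\<^sup>2)" by (rule g_le[OF z R])
  qed (use that in auto)
  \<comment> \<open>right, top and left side of the box, of total length \<open>4 R\<close>\<close>
  have total: "cmod (\<Gamma> (Complex R 0) - \<Gamma> (Complex (-R) 0)) \<le> 8 * R / (R\<^sup>2 - l\<^sup>2)" if R: "l < R" for R
  proof -
    have R0: "0 < R" using R l by simp
    have 1: "cmod (\<Gamma> (Complex R 0) - \<Gamma> (Complex R R)) \<le> 2 / (R\<^sup>2 - l\<^sup>2) * cmod (Complex R 0 - Complex R R)"
    proof (rule side[of "{z. R \<le> Re z} \<inter> {z. 0 \<le> Im z}"])
      fix z assume "z \<in> {z. R \<le> Re z} \<inter> {z. 0 \<le> Im z}"
      then show "0 \<le> Im z \<and> R \<le> cmod z" using complex_Re_le_cmod[of z] by simp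
    qed (use R R0 in \<open>auto intro!: convex_Int convex_halfspace_Re_ge convex_halfspace_Im_ge\<close>)
    have 2: "cmod (\<Gamma> (Complex R R) - \<Gamma> (Complex (-R) R)) \<le> 2 / (R\<^sup>2 - l\<^sup>2) * cmod (Complex R R - Complex (-R) R)"
    proof (rule side[of "{z. R \<le> Im z}"])
      fix z assume "z \<in> {z. R \<le> Im z}"
      then show "0 \<le> Im z \<and> R \<le> cmod z" using abs_Im_le_cmod[of z] R0 by simp
    qed (use R in \<open>auto intro!: convex_halfspace_Im_ge\<close>)
    have 3: "cmod (\<Gamma> (Complex (-R) R) - \<Gamma> (Complex (-R) 0)) \<le> 2 / (R\<^sup>2 - l\<^sup>2) * cmod (Complex (-R) R - Complex (-R) 0)"
    proof (rule side[of "{z. Re z \<le> -R} \<inter> {z. 0 \<le> Im z}"])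
      fix z assume "z \<in> {z. Re z \<le> -R} \<inter> {z. 0 \<le> Im z}"
      then show "0 \<le> Im z \<and> R \<le> cmod z" using abs_Re_le_cmod[of z] by auto
    qed (use R R0 in \<open>auto intro!: convex_Int convex_halfspace_Re_le convex_halfspace_Im_ge\<close>)
    have len: "cmod (Complex R 0 - Complex R R) = R" "cmod (Complex R R - Complex (-R) R) = 2 * R"
      "cmod (Complex (-R) R - Complex (-R) 0) = R"
      using R0 by (simp_all add: cmod_def real_sqrt_mult)
    have "\<Gamma> (Complex R 0) - \<Gamma> (Complex (-R) 0) = (\<Gamma> (Complex R 0) - \<Gamma> (Complex R R))
       + (\<Gamma> (Complex R R) - \<Gamma> (Complex (-R) R)) + (\<Gamma> (Complex (-R) R) - \<Gamma> (Complex (-R) 0))" by simp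
    also have "cmod \<dots> \<le> 2 / (R\<^sup>2 - l\<^sup>2) * R + 2 / (R\<^sup>2 - l\<^sup>2) * (2 * R) + 2 / (R\<^sup>2 - l\<^sup>2) * R"
      using 1 2 3 unfolding len by (intro order_trans[OF norm_triangle_ineq] add_mono) auto
    finally show ?thesis by (simp add: field_simps)
  qed
  have g_real: "g (Complex x 0) = of_real (pi / l) * (exp (\<i> * of_real t * of_real x) * of_real (poisson l x) - f a * of_real (poisson l x))" for x
  proof -
    have "Complex x 0 \<noteq> a" using l by (auto simp: a_def complex_eq_iff)
    have "of_real (poisson l x) = complex_of_real (l / pi) / (of_real x ^ 2 + of_real (l\<^sup>2))"
      unfolding poisson_def by (simp add: add.commute)
    then have "1 / (of_real x ^ 2 + of_real (l\<^sup>2)) = complex_of_real (pi / l) * of_real (poisson l x)"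
      using l by simp
    moreover have "g (Complex x 0) = (f (of_real x) - f a) * (1 / (of_real x ^ 2 + of_real (l\<^sup>2)))"
      unfolding g_eq[OF \<open>Complex x 0 \<noteq> a\<close>] by (simp add: complex_of_real_def)
    ultimately show ?thesis
      by (simp only: f_def) (simp only: algebra_simps)
  qed
  have int: "integrable lborel (\<lambda>x. exp (\<i> * of_real t * of_real x) * of_real (poisson l x) - f a * of_real (poisson l x))"
    by (intro Bochner_Integration.integrable_diff integrable_exp_poisson l integrable_mult_right integrable_of_real integrable_poisson)
  then have int_g: "integrable lborel (\<lambda>x. g (Complex x 0))"
    unfolding g_real by (rule integrable_mult_right)
  have "((\<lambda>R. \<integral>x. indicator {-R..R} x *\<^sub>R g (Complex x 0) \<partial>lborel) \<longlongrightarrow> (\<integral>x. g (Complex x 0) \<partial>lborel)) at_top"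
    by (rule tendsto_symmetric_integral_at_top[OF int_g])
  moreover have "((\<lambda>R. \<integral>x. indicator {-R..R} x *\<^sub>R g (Complex x 0) \<partial>lborel) \<longlongrightarrow> 0) at_top"
  proof (rule Lim_null_comparison)
    show "\<forall>\<^sub>F R in at_top. cmod (\<integral>x. indicator {-R..R} x *\<^sub>R g (Complex x 0) \<partial>lborel) \<le> 8 * R / (R\<^sup>2 - l\<^sup>2)"
      using eventually_gt_at_top[of l]
    proof eventually_elim
      case (elim R)
      have "(\<integral>x. indicator {-R..R} x *\<^sub>R g (Complex x 0) \<partial>lborel) = \<Gamma> (Complex R 0) - \<Gamma> (Complex (-R) 0)"
        by (rule integral_over_horizontal_segment)
           (use elim l in \<open>auto intro!: \<Gamma> continuous_on_horizontal_line[OF g] simp: S_def\<close>)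
      with total[OF elim] show ?case by simp
    qed
    show "((\<lambda>R. 8 * R / (R\<^sup>2 - l\<^sup>2)) \<longlongrightarrow> 0) at_top" by real_asymp
  qed
  ultimately have "(\<integral>x. g (Complex x 0) \<partial>lborel) = 0"
    using tendsto_unique[OF trivial_limit_at_top_linorder] by blast
  then have "(\<integral>x. exp (\<i> * of_real t * of_real x) * of_real (poisson l x) - f a * of_real (poisson l x) \<partial>lborel) = 0"
    using l by (simp add: g_real)
  then have "(\<integral>x. exp (\<i> * of_real t * of_real x) * of_real (poisson l x) \<partial>lborel)
      - f a * (\<integral>x. of_real (poisson l x) \<partial>lborel) = 0"
    by (subst (asm) Bochner_Integration.integral_diff)
       (auto intro!: integrable_exp_poisson l integrable_poisson)
  then show ?thesis using integral_poisson[OF l] by (simp add: fa)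
qed

lemma fourier_poisson:
  assumes l: "0 < l"
  shows "(\<integral>x. exp (\<i> * of_real t * of_real x) * of_real (poisson l x) \<partial>lborel) = of_real (exp (- l * \<bar>t\<bar>))"
proof (cases "0 \<le> t")
  case False
  have "(\<integral>x. exp (\<i> * of_real t * of_real x) * of_real (poisson l x) \<partial>lborel) =
    (\<integral>x. cnj (exp (\<i> * of_real (- t) * of_real x) * of_real (poisson l x)) \<partial>lborel)"
    by (simp add: exp_cnj)
  also have "\<dots> = cnj (\<integral>x. exp (\<i> * of_real (- t) * of_real x) * of_real (poisson l x) \<partial>lborel)"
    by (rule Bochner_Integration.integral_cnj)
  also have "\<dots> = of_real (exp (- l * \<bar>t\<bar>))"
    using False by (subst fourier_poisson_nonneg[OF l]) auto
  finally show ?thesis .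
qed (use fourier_poisson_nonneg[OF l] in auto)

lemma phi_eq_integral:
  assumes l: "0 < l"
  shows "phi l t = (\<integral>x. exp (\<i> * of_real t * of_real x) * of_real (poisson l x) \<partial>lborel)"
proof -
  have "phi l t = (\<integral>x. poisson l x *\<^sub>R exp (\<i> * of_real (t * x)) \<partial>lborel)"
    unfolding phi_def char_def
    by (subst integral_density)
       (use l poisson_pos[OF l] continuous_on_poisson[OF l] in
         \<open>auto intro!: borel_measurable_continuous_onI continuous_intros simp: less_imp_le\<close>)
  then show ?thesis by (simp add: scaleR_conv_of_real mult_ac)
qed

lemma phi_eq_exp: "0 < l \<Longrightarrow> phi l t = of_real (exp (- l * \<bar>t\<bar>))"
  by (simp add: phi_eq_integral fourier_poisson)

section \<open>Reflection positivity\<close>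

lemma cnj_mult_sum_eq_norm_sq:
  "(\<Sum>x\<in>S. \<Sum>y\<in>S. cnj (f x) * f y) = of_real ((cmod (\<Sum>x\<in>S. f x))\<^sup>2)"
  by (simp add: complex_norm_square sum_product cnj_sum mult.commute del: of_real_power)
     (rule sum.swap)

text \<open>
  The form of \<open>phi l (t - s)\<close> is the integral of \<open>\<bar>\<Sum> c u exp (- \<i> u x)\<bar>\<^sup>2\<close> against the Poisson kernel.
  For positive \<open>t\<close> and \<open>s\<close> the kernel \<open>phi l (t + s) = exp (- l t) exp (- l s)\<close> has rank one.
\<close>

lemma reflection_positive_phi:
  assumes l: "0 < l"
  shows "reflection_positive (phi l)"
  unfolding reflection_positive_def
proof (intro conjI allI)
  show "phi l (- t) = phi l t" for t by (simp add: phi_eq_exp[OF l])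
  show "positive_definite_kernel_on UNIV (\<lambda>t s. phi l (t - s))"
    unfolding positive_definite_kernel_on_def
  proof (intro allI impI)
    fix S :: "real set" and c :: "real \<Rightarrow> complex" assume "finite S \<and> S \<subseteq> UNIV"
    \<comment> \<open>the sign makes \<open>cnj (E u x) * E v x\<close> the character at \<open>u - v\<close> rather than \<open>v - u\<close>\<close>
    define E where "E u x = exp (\<i> * of_real (- u) * of_real x)" for u x :: real
    have E: "cnj (E u x) * E v x = exp (\<i> * of_real (u - v) * of_real x)" for u v x
      by (simp add: E_def exp_cnj algebra_simps flip: exp_add)
    have "(\<Sum>u\<in>S. \<Sum>v\<in>S. cnj (c u) * c v * phi l (u - v)) =
       (\<Sum>u\<in>S. \<Sum>v\<in>S. (\<integral>x. cnj (c u) * c v * (exp (\<i> * of_real (u - v) * of_real x) * of_real (poisson l x)) \<partial>lborel))"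
      unfolding phi_eq_integral[OF l] by simp
    also have "\<dots> = (\<integral>x. (\<Sum>u\<in>S. \<Sum>v\<in>S. cnj (c u) * c v * (exp (\<i> * of_real (u - v) * of_real x) * of_real (poisson l x))) \<partial>lborel)"
      using integrable_exp_poisson[OF l]
      by (simp only: Bochner_Integration.integral_sum Bochner_Integration.integrable_sum
          integrable_mult_right cong: sum.cong)
    also have "\<dots> = (\<integral>x. of_real (poisson l x * (cmod (\<Sum>u\<in>S. c u * E u x))\<^sup>2) \<partial>lborel)"
    proof (rule Bochner_Integration.integral_cong[OF refl])
      fix x
      have "(\<Sum>u\<in>S. \<Sum>v\<in>S. cnj (c u) * c v * (exp (\<i> * of_real (u - v) * of_real x) * of_real (poisson l x)))
         = of_real (poisson l x) * (\<Sum>u\<in>S. \<Sum>v\<in>S. cnj (c u * E u x) * (c v * E v x))"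
        unfolding E[symmetric] by (simp add: sum_distrib_left mult_ac)
      then show "(\<Sum>u\<in>S. \<Sum>v\<in>S. cnj (c u) * c v * (exp (\<i> * of_real (u - v) * of_real x) * of_real (poisson l x)))
         = of_real (poisson l x * (cmod (\<Sum>u\<in>S. c u * E u x))\<^sup>2)"
        by (simp only: cnj_mult_sum_eq_norm_sq of_real_mult)
    qed
    also have "\<dots> = of_real (\<integral>x. poisson l x * (cmod (\<Sum>u\<in>S. c u * E u x))\<^sup>2 \<partial>lborel)"
      by (rule integral_complex_of_real)
    finally show "(\<Sum>u\<in>S. \<Sum>v\<in>S. cnj (c u) * c v * phi l (u - v)) \<in> \<real>\<^sub>\<ge>\<^sub>0"
      using less_imp_le[OF poisson_pos[OF l]] by (simp only: nonneg_Reals_of_real_iff) simp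
  qed
  show "positive_definite_kernel_on {0<..} (\<lambda>t s. phi l (t + s))"
    unfolding positive_definite_kernel_on_def
  proof (intro allI impI)
    fix S :: "real set" and c :: "real \<Rightarrow> complex" assume S: "finite S \<and> S \<subseteq> {0<..}"
    have "(\<Sum>u\<in>S. \<Sum>v\<in>S. cnj (c u) * c v * phi l (u + v)) =
      (\<Sum>u\<in>S. \<Sum>v\<in>S. cnj (c u * of_real (exp (- l * u))) * (c v * of_real (exp (- l * v))))"
    proof (intro sum.cong refl)
      fix u v assume "u \<in> S" "v \<in> S"
      then have "\<bar>u + v\<bar> = u + v" using S by (intro abs_of_pos add_pos_pos) auto
      then show "cnj (c u) * c v * phi l (u + v) =
          cnj (c u * of_real (exp (- l * u))) * (c v * of_real (exp (- l * v)))"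
        by (simp add: phi_eq_exp[OF l] distrib_left exp_diff exp_minus field_simps exp_add)
    qed
    then show "(\<Sum>u\<in>S. \<Sum>v\<in>S. cnj (c u) * c v * phi l (u + v)) \<in> \<real>\<^sub>\<ge>\<^sub>0"
      unfolding cnj_mult_sum_eq_norm_sq by (simp only: nonneg_Reals_of_real_iff zero_le_power2)
  qed
qed

section \<open>The outer function\<close>

lemma F_outer_eq:
  assumes l: "0 < l"
  shows "F_outer l z = of_real (sqrt (l / pi)) * (\<i> / (z + \<i> * of_real l))"
proof -
  have "szego (\<i> * of_real l) (\<i> * of_real l) = of_real (1 / (4 * pi * l))"
    using l by (simp add: szego_def field_simps)
  then have csqrt: "csqrt (szego (\<i> * of_real l) (\<i> * of_real l)) = of_real (sqrt (1 / (4 * pi * l)))"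
    using l by (simp add: csqrt_of_real del: of_real_divide)
  have "1 / (2 * pi) / sqrt (1 / (4 * pi * l)) = sqrt (l / pi)"
  proof (rule real_sqrt_unique[symmetric])
    show "(1 / (2 * pi) / sqrt (1 / (4 * pi * l)))\<^sup>2 = l / pi"
      using l by (simp add: power_divide power_mult_distrib) (simp add: field_simps power2_eq_square)
  qed (use l in simp)
  then have "complex_of_real (sqrt (l / pi)) = 1 / (2 * of_real pi) / of_real (sqrt (1 / (4 * pi * l)))"
    by (metis of_real_divide of_real_1 of_real_mult of_real_numeral)
  then show ?thesis
    unfolding F_outer_def csqrt by (simp add: szego_def)
qed

lemma F_outer_holomorphic:
  assumes l: "0 < l"
  shows "F_outer l holomorphic_on {z. - l < Im z}"
  unfolding F_outer_eq[OF l, abs_def]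
  by (intro holomorphic_intros) (auto simp: complex_eq_iff)

text \<open>
  At height \<open>0\<close> this is the Poisson kernel itself; at positive height the integral is
  \<open>l / (l + y) \<le> 1\<close>, which puts \<open>F_outer l\<close> into \<open>H\<^sup>2\<close>.
\<close>

lemma norm_F_outer_sq:
  assumes l: "0 < l" and y: "0 \<le> y"
  shows "(cmod (F_outer l (Complex x y)))\<^sup>2 = l / (l + y) * poisson (l + y) x"
proof -
  have "Complex x y + \<i> * of_real l = Complex x (l + y)" by (simp add: complex_eq_iff)
  then show ?thesis
    using l y by (simp add: F_outer_eq norm_mult norm_divide power_mult_distrib power_divide poisson_def
        cmod_power2 add.commute)
qed

lemma F_outer_in_H2:
  assumes l: "0 < l"
  shows "F_outer l \<in> H2"
  unfolding H2_iff
proof (intro conjI exI[of _ 1] allI impI)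
  show "F_outer l holomorphic_on upper_half_plane"
    by (rule holomorphic_on_subset[OF F_outer_holomorphic[OF l]]) (use l in \<open>auto simp: upper_half_plane_def\<close>)
  fix y :: real assume y: "0 < y"
  have "has_bochner_integral lborel (\<lambda>x. (cmod (F_outer l (Complex x y)))\<^sup>2) (l / (l + y) * 1)"
    unfolding norm_F_outer_sq[OF l less_imp_le[OF y]]
    by (rule has_bochner_integral_mult_right[OF has_bochner_integral_poisson]) (use l y in simp)
  then show "integrable lborel (\<lambda>x. (cmod (F_outer l (Complex x y)))\<^sup>2)" "line_energy (F_outer l) y \<le> 1"
    using l y by (simp_all add: has_bochner_integral_iff line_energy_def)
qed simp

text \<open>
  The approximants \<open>G (z + \<i> d) cutoff n (z + \<i> d)\<close> of \<open>H2_approximation\<close> are of the form \<open>g F_outer l\<close> with \<open>g\<close> bounded: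
  dividing by \<open>F_outer l\<close> multiplies by \<open>z + \<i> l\<close> up to a constant, and the cutoff absorbs this factor.
\<close>

lemma outer_F_outer:
  assumes l: "0 < l"
  shows "outer_H2 (F_outer l)"
  unfolding outer_H2_def
proof (intro conjI ballI allI impI)
  show "F_outer l \<in> H2" by (rule F_outer_in_H2[OF l])
  fix G and \<epsilon> :: real assume G: "G \<in> H2" and \<epsilon>: "0 < \<epsilon>"
  obtain n d where n: "0 < n" and d: "0 < d" and
    approx: "hardy_norm_sq (\<lambda>z. G z - G (z + \<i> * of_real d) * cutoff n (z + \<i> * of_real d)) \<le> ennreal (\<epsilon>\<^sup>2 / 2)"
    using H2_approximation[OF G, of "\<epsilon>\<^sup>2 / 2"] \<epsilon> by auto
  define c where "c = complex_of_real (sqrt (l / pi)) * \<i>"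
  have c: "c \<noteq> 0" using l by (simp add: c_def)
  define g where "g z = G (z + \<i> * of_real d) * cutoff n (z + \<i> * of_real d) * (z + \<i> * of_real l) / c" for z
  have gF: "g z * F_outer l z = G (z + \<i> * of_real d) * cutoff n (z + \<i> * of_real d)"
    if "z \<in> upper_half_plane" for z
  proof -
    have "z + \<i> * of_real l \<noteq> 0" using that l by (auto simp: upper_half_plane_def complex_eq_iff)
    moreover have "F_outer l z = c / (z + \<i> * of_real l)" by (simp add: F_outer_eq[OF l] c_def)
    ultimately show ?thesis using c by (simp add: g_def)
  qed
  have "g \<in> Hinf"
    unfolding Hinf_def
  proof (intro CollectI conjI)
    have shift: "(\<lambda>z. f (z + \<i> * of_real d)) holomorphic_on upper_half_plane"
      if "f holomorphic_on upper_half_plane" for f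
    proof -
      have "f \<circ> (\<lambda>z. z + \<i> * of_real d) holomorphic_on upper_half_plane"
        by (rule holomorphic_on_compose_gen[OF _ that])
           (use d upper_half_plane_shift in \<open>auto intro!: holomorphic_intros\<close>)
      then show ?thesis by (simp add: o_def)
    qed
    show "g holomorphic_on upper_half_plane"
      unfolding g_def[abs_def]
      using shift[OF H2_holomorphic[OF G]] shift[OF cutoff_holomorphic] c
      by (intro holomorphic_on_divide holomorphic_on_mult holomorphic_on_add holomorphic_on_const holomorphic_on_ident)
    obtain B where B: "\<And>z. d \<le> Im z \<Longrightarrow> cmod (G z) \<le> B" using H2_bounded_above_line[OF G d] by blast
    have B0: "0 \<le> B" using order_trans[OF norm_ge_zero B[of "\<i> * of_real d"]] by simp
    \<comment> \<open>\<open>(z + \<i> l) / w = 1 + \<i> (l - (d + n)) / w\<close> for \<open>w = z + \<i> (d + n)\<close>, and \<open>\<bar>w\<bar> \<ge> d + n\<close>\<close>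
    define D where "D = real n * (1 + \<bar>l - (d + real n)\<bar> / (d + real n))"
    have cut: "cmod (cutoff n (z + \<i> * of_real d) * (z + \<i> * of_real l)) \<le> D" if z: "0 < Im z" for z
    proof -
      define w where "w = z + \<i> * of_real d + \<i> * of_nat n"
      have w: "d + real n \<le> cmod w" using abs_Im_le_cmod[of w] z by (simp add: w_def)
      have w0: "0 < cmod w" using w d by linarith
      have "cutoff n (z + \<i> * of_real d) * (z + \<i> * of_real l) =
          \<i> * of_nat n * (1 + \<i> * of_real (l - (d + real n)) / w)"
        using w0 unfolding cutoff_def w_def[symmetric] by (simp add: field_simps) (simp add: w_def algebra_simps)
      also have "cmod \<dots> = real n * cmod (1 + \<i> * of_real (l - (d + real n)) / w)"
        by (simp only: norm_mult norm_ii norm_of_nat mult_1_left)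
      also have "\<dots> \<le> real n * (1 + cmod (\<i> * of_real (l - (d + real n)) / w))"
        by (intro mult_left_mono order_trans[OF norm_triangle_ineq]) auto
      also have "cmod (\<i> * of_real (l - (d + real n)) / w) = \<bar>l - (d + real n)\<bar> / cmod w"
        by (simp only: norm_mult norm_divide norm_ii norm_of_real mult_1_left)
      also have "\<bar>l - (d + real n)\<bar> / cmod w \<le> \<bar>l - (d + real n)\<bar> / (d + real n)"
        using w d by (intro divide_left_mono mult_pos_pos) auto
      finally show ?thesis unfolding D_def by (simp add: mult_left_mono)
    qed
    have "cmod (g z) \<le> B * D / cmod c" if "z \<in> upper_half_plane" for z
    proof -
      have z: "0 < Im z" using that by (simp add: upper_half_plane_def)
      have "cmod (g z) = cmod (G (z + \<i> * of_real d)) * cmod (cutoff n (z + \<i> * of_real d) * (z + \<i> * of_real l)) / cmod c"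
        by (simp add: g_def norm_mult norm_divide)
      also have "\<dots> \<le> B * D / cmod c"
        using z B0 by (intro divide_right_mono mult_mono B cut) auto
      finally show ?thesis .
    qed
    then show "bounded (g ` upper_half_plane)" unfolding bounded_iff by blast
  qed
  moreover have "hardy_norm_sq (\<lambda>z. G z - g z * F_outer l z) =
      hardy_norm_sq (\<lambda>z. G z - G (z + \<i> * of_real d) * cutoff n (z + \<i> * of_real d))"
    unfolding hardy_norm_sq_def
    by (intro SUP_cong refl nn_integral_cong) (simp add: gF upper_half_plane_def)
  then have "hardy_norm_sq (\<lambda>z. G z - g z * F_outer l z) < ennreal (\<epsilon>\<^sup>2)"
    using approx \<epsilon> by (auto intro!: le_less_trans[OF _ ennreal_lessI])
  ultimately show "\<exists>g\<in>Hinf. hardy_norm_sq (\<lambda>z. G z - g z * F_outer l z) < ennreal (\<epsilon>\<^sup>2)" by blast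
qed

section \<open>Boundary values\<close>

lemma has_nontangential_limit_isCont:
  assumes "isCont F (of_real x)"
  shows "has_nontangential_limit F x (F (of_real x))"
  unfolding has_nontangential_limit_def
  using assms by (auto simp: isCont_def intro: tendsto_within_subset)

text \<open>
  The vertex of a cone is a limit point of the cone, so the limit within one cone already determines the value.
  This makes \<open>boundary_value\<close> well defined.
\<close>

lemma has_nontangential_limit_unique:
  assumes "has_nontangential_limit F x v" "has_nontangential_limit F x w"
  shows "v = w"
proof -
  let ?C = "{z. Im z > 0 \<and> \<bar>Re z - x\<bar> < 1 * Im z}"
  have "complex_of_real x islimpt ?C"
    unfolding islimpt_approachable
  proof (intro allI impI)
    fix e :: real assume "0 < e"
    then show "\<exists>z\<in>?C. z \<noteq> complex_of_real x \<and> dist z (complex_of_real x) < e"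
      by (intro bexI[of _ "of_real x + \<i> * of_real (e / 2)"]) (auto simp: dist_norm norm_mult)
  qed
  then have "at (complex_of_real x) within ?C \<noteq> bot" by (simp add: trivial_limit_within)
  then show ?thesis
    using assms unfolding has_nontangential_limit_def
    by (meson tendsto_unique zero_less_one)
qed

lemma F_outer_boundary:
  assumes l: "0 < l"
  shows "has_nontangential_limit (F_outer l) x (F_outer l (of_real x))"
    and "boundary_value (F_outer l) x = F_outer l (of_real x)"
proof -
  have "open {z. - l < Im z}" by (intro open_Collect_less continuous_intros)
  then have "isCont (F_outer l) (of_real x)"
    using holomorphic_on_imp_continuous_on[OF F_outer_holomorphic[OF l]] l
    by (auto simp: continuous_on_eq_continuous_at)
  then show *: "has_nontangential_limit (F_outer l) x (F_outer l (of_real x))"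
    by (rule has_nontangential_limit_isCont)
  show "boundary_value (F_outer l) x = F_outer l (of_real x)"
    unfolding boundary_value_def using * has_nontangential_limit_unique by blast
qed

lemma norm_F_boundary_sq:
  "0 < l \<Longrightarrow> (cmod (boundary_value (F_outer l) x))\<^sup>2 = poisson l x"
  using norm_F_outer_sq[of l 0 x] by (simp add: F_outer_boundary complex_of_real_def)

lemma F_boundary_in_L2:
  assumes l: "0 < l"
  shows "boundary_value (F_outer l) \<in> L2"
proof -
  have "F_outer l holomorphic_on {z. - l < Im z}" by (rule F_outer_holomorphic[OF l])
  from borel_measurable_horizontal_line[OF this, of 0] l
  have "(\<lambda>x. boundary_value (F_outer l) x) \<in> borel_measurable borel"
    by (simp add: F_outer_boundary(2)[OF l] complex_of_real_def)
  then show ?thesis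
    using integrable_poisson[OF l] by (simp add: L2_def norm_F_boundary_sq[OF l])
qed

lemma h_fun_eq:
  assumes l: "0 < l"
  shows "h_fun l x = (\<i> * of_real l - of_real x) / (\<i> * of_real l + of_real x)"
    and "cmod (h_fun l x) = 1" and "h_fun l (- x) * h_fun l x = 1"
    and "h_fun l x * boundary_value (F_outer l) (- x) = boundary_value (F_outer l) x"
proof -
  have nz: "\<i> * of_real l + of_real x \<noteq> 0" "\<i> * of_real l - of_real x \<noteq> 0" for x
    using l by (auto simp: complex_eq_iff)
  have s: "complex_of_real (sqrt (l / pi)) \<noteq> 0" using l by simp
  show eq: "h_fun l x = (\<i> * of_real l - of_real x) / (\<i> * of_real l + of_real x)" for x
    using nz[of x] s by (simp add: h_fun_def F_outer_boundary[OF l] F_outer_eq[OF l] add.commute divide_simps)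
  have "cmod (\<i> * of_real l - of_real x) = cmod (\<i> * of_real l + of_real x)"
    by (simp add: cmod_def)
  then show "cmod (h_fun l x) = 1"
    using nz[of x] by (simp add: eq norm_divide)
  show "h_fun l (- x) * h_fun l x = 1"
    using nz[of x] by (simp add: eq)
  have "boundary_value (F_outer l) (- x) \<noteq> 0"
    using norm_F_boundary_sq[OF l, of "- x"] poisson_pos[OF l, of "- x"] by auto
  then show "h_fun l x * boundary_value (F_outer l) (- x) = boundary_value (F_outer l) x"
    by (simp add: h_fun_def)
qed

section \<open>Unitary operators on \<open>L\<^sup>2(\<real>)\<close>\<close>

lemma AE_lborel_uminus:
  fixes P :: "real \<Rightarrow> bool"
  assumes "AE x in lborel. P x"
  shows "AE x in lborel. P (- x)"
proof -
  have "AE x in distr lborel borel uminus. P x" using assms by (simp only: lborel_distr_uminus)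
  from AE_distrD[OF _ this] show ?thesis by simp
qed

lemma integral_lborel_uminus:
  fixes f :: "real \<Rightarrow> 'a :: {banach, second_countable_topology}"
  shows "(\<integral>x. f (- x) \<partial>lborel) = (\<integral>x. f x \<partial>lborel)"
  using lborel_integral_real_affine[of "-1" f 0] by simp

lemma L2_multiplier:
  assumes f: "f \<in> L2" and u: "u \<in> borel_measurable borel" and norm: "\<And>x. cmod (u x) = 1"
  shows "(\<lambda>x. u x * f x) \<in> L2"
  using f u norm by (simp add: L2_def norm_mult borel_measurable_times)

lemma L2_reflect:
  assumes f: "f \<in> L2"
  shows "(\<lambda>x. f (- x)) \<in> L2"
proof -
  have [measurable]: "f \<in> borel_measurable borel" using f by (simp add: L2_def)
  have "integrable lborel (\<lambda>x. (cmod (f x))\<^sup>2)" using f by (simp add: L2_def)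
  from lborel_integrable_real_affine[OF this, of "-1" 0] show ?thesis
    by (simp add: L2_def)
qed

text \<open>
  The condition \<open>h (- x) h x = 1\<close> makes \<open>theta h\<close> its own inverse, which also gives surjectivity.
\<close>

lemma L2_unitary_theta:
  assumes h: "h \<in> borel_measurable borel" and norm: "\<And>x. cmod (h x) = 1"
    and inv: "\<And>x. h (- x) * h x = 1"
  shows "L2_unitary_involution (theta h)"
proof -
  have L2: "theta h f \<in> L2" if "f \<in> L2" for f
    unfolding theta_def[abs_def] by (rule L2_multiplier[OF L2_reflect[OF that] h norm])
  have invol: "theta h (theta h f) = f" for f
    using inv by (simp add: theta_def[abs_def] mult.commute mult.left_commute flip: mult.assoc)
  have inner: "L2_inner (theta h f) (theta h g) = L2_inner f g" for f g
  proof -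
    have "cnj (h x) * h x = 1" for x
      using norm[of x] complex_norm_square[of "h x"] by (simp add: mult.commute)
    moreover have "cnj (theta h f x) * theta h g x = (cnj (h x) * h x) * (cnj (f (- x)) * g (- x))" for x
      by (simp add: theta_def)
    ultimately have "cnj (theta h f x) * theta h g x = cnj (f (- x)) * g (- x)" for x by simp
    then show ?thesis
      unfolding L2_inner_def using integral_lborel_uminus[of "\<lambda>x. cnj (f x) * g x"] by simp
  qed
  show ?thesis
    unfolding L2_unitary_involution_def L2_unitary_def
  proof (intro conjI ballI allI impI)
    fix f g assume "L2_eq f g"
    then have "AE x in lborel. f (- x) = g (- x)" unfolding L2_eq_def by (rule AE_lborel_uminus)
    then show "L2_eq (theta h f) (theta h g)" unfolding L2_eq_def theta_def by eventually_elim simp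
  next
    fix f g a b
    show "L2_eq (theta h (\<lambda>x. a * f x + b * g x)) (\<lambda>x. a * theta h f x + b * theta h g x)"
      unfolding L2_eq_def theta_def by (simp add: algebra_simps)
  next
    fix g assume "g \<in> L2"
    then show "\<exists>f\<in>L2. L2_eq (theta h f) g"
      by (intro bexI[of _ "theta h g"] L2) (simp_all add: invol L2_eq_def)
  qed (simp_all add: L2 invol inner L2_eq_def)
qed

lemma mod_group_measurable: "(\<lambda>x. exp (\<i> * of_real t * of_real x)) \<in> borel_measurable borel"
  by (intro borel_measurable_continuous_onI continuous_intros)

lemma mod_group_norm: "cmod (exp (\<i> * of_real t * of_real x)) = 1"
  by (simp add: norm_exp_eq_Re)

lemma mod_group_L2: "f \<in> L2 \<Longrightarrow> mod_group t f \<in> L2"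
  unfolding mod_group_def[abs_def] by (intro L2_multiplier mod_group_measurable mod_group_norm)

lemma mod_group_add: "mod_group (s + t) f = mod_group s (mod_group t f)"
  by (simp add: mod_group_def fun_eq_iff distrib_right distrib_left exp_add)

lemma mod_group_0: "mod_group 0 f = f"
  by (simp add: mod_group_def fun_eq_iff)

lemma L2_unitary_mod_group: "L2_unitary (mod_group t)"
  unfolding L2_unitary_def
proof (intro conjI ballI allI impI)
  fix f g assume "L2_eq f g"
  then show "L2_eq (mod_group t f) (mod_group t g)"
    unfolding L2_eq_def mod_group_def by eventually_elim simp
next
  fix f g a b
  show "L2_eq (mod_group t (\<lambda>x. a * f x + b * g x)) (\<lambda>x. a * mod_group t f x + b * mod_group t g x)"
    unfolding L2_eq_def mod_group_def by (simp add: algebra_simps)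
next
  fix f g
  have "cnj (exp (\<i> * of_real t * of_real x)) * exp (\<i> * of_real t * of_real x) = 1" for x
    by (simp add: exp_cnj flip: exp_add)
  moreover have "cnj (mod_group t f x) * mod_group t g x =
      (cnj (exp (\<i> * of_real t * of_real x)) * exp (\<i> * of_real t * of_real x)) * (cnj (f x) * g x)" for x
    by (simp only: mod_group_def complex_cnj_mult mult_ac)
  ultimately have "cnj (mod_group t f x) * mod_group t g x = cnj (f x) * g x" for x
    by (simp only: mult_1_left)
  then show "L2_inner (mod_group t f) (mod_group t g) = L2_inner f g"
    by (simp add: L2_inner_def)
next
  fix g assume "g \<in> L2"
  then show "\<exists>f\<in>L2. L2_eq (mod_group t f) g"
    by (intro bexI[of _ "mod_group (- t) g"] mod_group_L2)
       (simp_all add: L2_eq_def mod_group_0 flip: mod_group_add)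
qed (rule mod_group_L2)

text \<open>
  Dominated convergence: the integrand tends to \<open>0\<close> pointwise and is at most \<open>4 \<bar>f\<bar>\<^sup>2\<close>.
\<close>

lemma mod_group_strongly_continuous:
  assumes f: "f \<in> L2"
  shows "((\<lambda>s. L2_norm (\<lambda>x. mod_group s f x - mod_group t f x)) \<longlongrightarrow> 0) (at t)"
  unfolding tendsto_at_iff_sequentially
proof (intro allI impI)
  fix X :: "nat \<Rightarrow> real" assume X: "\<forall>i. X i \<in> UNIV - {t}" "X \<longlonglongrightarrow> t"
  have [measurable]: "f \<in> borel_measurable borel" using f by (simp add: L2_def)
  have [measurable]: "mod_group s f \<in> borel_measurable borel" for s
    using mod_group_L2[OF f, of s] by (simp add: L2_def)
  have "(\<lambda>n. \<integral>x. (cmod (mod_group (X n) f x - mod_group t f x))\<^sup>2 \<partial>lborel) \<longlonglongrightarrow> (\<integral>x. 0 \<partial>(lborel :: real measure))"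
  proof (rule integral_dominated_convergence[where w = "\<lambda>x. 4 * (cmod (f x))\<^sup>2"])
    show "integrable lborel (\<lambda>x. 4 * (cmod (f x))\<^sup>2)" using f by (simp add: L2_def)
    show "AE x in lborel. (\<lambda>n. (cmod (mod_group (X n) f x - mod_group t f x))\<^sup>2) \<longlonglongrightarrow> 0"
    proof (rule AE_I2)
      fix x
      have "(\<lambda>n. (cmod (mod_group (X n) f x - mod_group t f x))\<^sup>2) \<longlonglongrightarrow> (cmod (mod_group t f x - mod_group t f x))\<^sup>2"
        unfolding mod_group_def by (intro tendsto_intros X(2))
      then show "(\<lambda>n. (cmod (mod_group (X n) f x - mod_group t f x))\<^sup>2) \<longlonglongrightarrow> 0" by simp
    qed
    fix n
    show "AE x in lborel. norm ((cmod (mod_group (X n) f x - mod_group t f x))\<^sup>2) \<le> 4 * (cmod (f x))\<^sup>2"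
    proof (rule AE_I2)
      fix x
      have "cmod (mod_group s f x) = cmod (f x)" for s
        by (simp only: mod_group_def norm_mult mod_group_norm mult_1_left)
      then show "norm ((cmod (mod_group (X n) f x - mod_group t f x))\<^sup>2) \<le> 4 * (cmod (f x))\<^sup>2"
        using norm_diff_sq_le[of "mod_group (X n) f x" "mod_group t f x"] by simp
    qed
  qed auto
  from tendsto_real_sqrt[OF this]
  show "((\<lambda>s. L2_norm (\<lambda>x. mod_group s f x - mod_group t f x)) \<circ> X) \<longlonglongrightarrow> 0"
    by (simp add: L2_norm_def o_def)
qed

section \<open>The reflection positive function and its outer factor\<close>

theorem proposition3p1:
  fixes l :: real
  assumes "l > 0"
  shows
    "((\<forall>x. poisson l x > 0) \<and>
      reflection_positive (phi l) \<and>
      (\<forall>t. phi l t = (\<integral>x. exp (\<i> * of_real t * of_real x) * of_real (poisson l x) \<partial>lborel) \<and>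
           phi l t = of_real (exp (- l * \<bar>t\<bar>)))) \<and>
     ((\<forall>z\<in>upper_half_plane.
         F_outer l z = of_real (sqrt (l / pi)) * (\<i> / (z + \<i> * of_real l))) \<and>
      outer_H2 (F_outer l) \<and>
      (\<forall>x. has_nontangential_limit (F_outer l) x (boundary_value (F_outer l) x)) \<and>
      boundary_value (F_outer l) \<in> L2 \<and>
      (\<forall>x. (cmod (boundary_value (F_outer l) x))\<^sup>2 = poisson l x) \<and>
      (\<forall>x. h_fun l x = (\<i> * of_real l - of_real x) / (\<i> * of_real l + of_real x) \<and>
           cmod (h_fun l x) = 1) \<and>
      L2_unitary_involution (theta (h_fun l)) \<and>
      L2_eq (theta (h_fun l) (boundary_value (F_outer l))) (boundary_value (F_outer l)) \<and>
      L2_unitary_one_parameter_group mod_group \<and>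
      (\<forall>t. L2_inner (boundary_value (F_outer l)) (mod_group t (boundary_value (F_outer l)))
             = phi l t))"
proof -
  let ?F = "boundary_value (F_outer l)"
  note l = assms
  have h: "h_fun l \<in> borel_measurable borel"
    unfolding h_fun_eq(1)[OF l, abs_def]
    by (intro borel_measurable_continuous_onI continuous_intros) (use l in \<open>auto simp: complex_eq_iff\<close>)
  have theta: "L2_unitary_involution (theta (h_fun l))"
    by (rule L2_unitary_theta[OF h h_fun_eq(2)[OF l] h_fun_eq(3)[OF l]])
  have fixed: "L2_eq (theta (h_fun l) ?F) ?F"
    by (simp add: L2_eq_def theta_def h_fun_eq(4)[OF l])
  have group: "L2_unitary_one_parameter_group mod_group"
    unfolding L2_unitary_one_parameter_group_def
    by (simp add: L2_unitary_mod_group mod_group_strongly_continuous mod_group_0 L2_eq_def flip: mod_group_add)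
  have inner: "L2_inner ?F (mod_group t ?F) = phi l t" for t
  proof -
    have "cnj (?F x) * mod_group t ?F x = exp (\<i> * of_real t * of_real x) * of_real (poisson l x)" for x
      unfolding mod_group_def norm_F_boundary_sq[OF l, of x, symmetric] complex_norm_square
      by (simp only: mult_ac)
    then show ?thesis by (simp add: L2_inner_def phi_eq_integral[OF l])
  qed
  show ?thesis
    using poisson_pos[OF l] reflection_positive_phi[OF l] phi_eq_integral[OF l] phi_eq_exp[OF l]
      F_outer_eq[OF l] outer_F_outer[OF l] F_outer_boundary[OF l] F_boundary_in_L2[OF l]
      norm_F_boundary_sq[OF l] h_fun_eq(1,2)[OF l] theta fixed group inner
    by simp
qed

end
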